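(* Every finite semidistributive lattice is semidistrim, and every finite trim lattice is semidistrim.
   Context: All lattices are finite. For a lattice $L$, $\mathcal{J}_L$ (resp. $\mathcal{M}_L$) is the set of join-irreducible (resp. meet-irreducible) elements; for $j\in\mathcal{J}_L$, $j_*$ is the unique element covered by $j$, and for $m\in\mathcal{M}_L$, $m^*$ is the unique element covering $m$. Let $\mathcal{M}_L(j)=\max\{z\in L: j_*=j\wedge z\}$ and $\mathcal{J}_L(m)=\min\{z\in L: m^*=m\vee z\}$. A pairing on $L$ is a bijection $\kappa:\mathcal{J}_L\to\mathcal{M}_L$ with $\kappa(j)\in\mathcal{M}_L(j)$ for all $j$ and $\kappa^{-1}(m)\in\mathcal{J}_L(m)$ for all $m$; $L$ is uniquely paired if it has exactly one pairing, denoted $\kappa_L$. A prime pair is a pair $(j_0,m_0)$ with $L=[\hat0,m_0]\sqcup[j_0,\hat1]$. A uniquely paired lattice $L$ is compatibly dismantlable if $|L|=1$ or there is a prime pair $(j_0,m_0)$ such that: (i) $[j_0,\hat1]$ is compatibly dismantlable and $\alpha(j)=j_0\vee j$ defines a bijection $\{j\in\mathcal{J}_L: j_0\le\kappa_L(j)\}\to\mathcal{J}_{[j_0,\hat1]}$ with $\kappa_{[j_0,\hat1]}(\alpha(j))=\kappa_L(j)$; (ii) $[\hat0,m_0]$ is compatibly dismantlable and $\beta(m)=m_0\wedge m$ defines a bijection $\{m\in\mathcal{M}_L:\kappa_L^{-1}(m)\le m_0\}\to\mathcal{M}_{[\hat0,m_0]}$ with $\kappa_{[\hat0,m_0]}^{-1}(\beta(m))=\kappa_L^{-1}(m)$.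 The Galois graph $G_L$ of a uniquely paired $L$ is the directed graph on $\mathcal{J}_L$ with an edge $j\to j'$ iff $j\ne j'$ and $j\not\le\kappa_L(j')$. For $x\in L$ let $J_L(x)=\{j\in\mathcal{J}_L:j\le x\}$ and $M_L(x)=\{j\in\mathcal{J}_L:\kappa_L(j)\ge x\}$. For a compatibly dismantlable $L$, for every cover $x\lessdot y$ the set $M_L(x)\cap J_L(y)$ has exactly one element $j_{xy}$; set $\mathcal{D}_L(x)=\{j_{yx}:y\lessdot x\}$ and $\mathcal{U}_L(x)=\{j_{xy}:x\lessdot y\}$. $L$ is semidistrim if it is compatibly dismantlable and $\mathcal{D}_L(x)$, $\mathcal{U}_L(x)$ are independent sets (no two elements adjacent) of $G_L$ for all $x\in L$. A lattice is semidistributive if it is join-semidistributive ($x\vee y=x\vee z\Rightarrow x\vee(y\wedge z)=x\vee y$) and meet-semidistributive ($x\wedge y=x\wedge z\Rightarrow x\wedge(y\vee z)=x\wedge y$). A lattice is extremal if it has a maximum-length chain $\hat0=x_0\lessdot\cdots\lessdot x_n=\hat1$ with $|\mathcal{J}_L|=|\mathcal{M}_L|=n$; $x$ is left modular if $(y\vee x)\wedge z=y\vee(x\wedge z)$ for all $y\le z$; $L$ is left modular if it has a maximal chain of left modular elements; $L$ is trim if it is extremal and left modular. *)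

theory Defs
  imports Main "HOL-Library.FuncSet"
begin

text \<open>
  Passing from a lattice to its intervals stays inside one ambient lattice, so a finite lattice
  is represented by a finite nonempty sublattice \<^term>\<open>L\<close> of a type of class
  \<^class>\<open>lattice\<close>, possibly \<^term>\<open>UNIV\<close>. Its joins and meets are then \<^const>\<open>sup\<close> and
  \<^const>\<open>inf\<close>, whereas covers, irreducibles and so on are relative to \<^term>\<open>L\<close>. The
  definitions below are meant for such \<^term>\<open>L\<close> only. For \<^term>\<open>a \<in> L\<close> the intervals from
  the bottom to \<^term>\<open>a\<close> and from \<^term>\<open>a\<close> to the top are \<^term>\<open>L \<inter> {..a}\<close> and
  \<^term>\<open>L \<inter> {a..}\<close>.
\<close>

definition finite_sublattice :: "'a::lattice set \<Rightarrow> bool" where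
  "finite_sublattice L \<longleftrightarrow>
     finite L \<and> L \<noteq> {} \<and> (\<forall>x\<in>L. \<forall>y\<in>L. inf x y \<in> L \<and> sup x y \<in> L)"

definition covered_by :: "'a::lattice set \<Rightarrow> 'a \<Rightarrow> 'a \<Rightarrow> bool" where
  "covered_by L x y \<longleftrightarrow> x \<in> L \<and> y \<in> L \<and> x < y \<and> \<not> (\<exists>z\<in>L. x < z \<and> z < y)"

definition join_irreducibles :: "'a::lattice set \<Rightarrow> 'a set" where
  "join_irreducibles L = {j \<in> L. \<exists>!x. covered_by L x j}"

definition meet_irreducibles :: "'a::lattice set \<Rightarrow> 'a set" where
  "meet_irreducibles L = {m \<in> L. \<exists>!y. covered_by L m y}"

definition lower_cover :: "'a::lattice set \<Rightarrow> 'a \<Rightarrow> 'a" where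
  "lower_cover L j = (THE x. covered_by L x j)"

definition upper_cover :: "'a::lattice set \<Rightarrow> 'a \<Rightarrow> 'a" where
  "upper_cover L m = (THE y. covered_by L m y)"

definition maximal_elements :: "'a::lattice set \<Rightarrow> 'a set" where
  "maximal_elements S = {z \<in> S. \<not> (\<exists>w\<in>S. z < w)}"

definition minimal_elements :: "'a::lattice set \<Rightarrow> 'a set" where
  "minimal_elements S = {z \<in> S. \<not> (\<exists>w\<in>S. w < z)}"

definition max_partners :: "'a::lattice set \<Rightarrow> 'a \<Rightarrow> 'a set" where
  "max_partners L j = maximal_elements {z \<in> L. lower_cover L j = inf j z}"

definition min_partners :: "'a::lattice set \<Rightarrow> 'a \<Rightarrow> 'a set" where
  "min_partners L m = minimal_elements {z \<in> L. upper_cover L m = sup m z}"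

text \<open>
  A pairing is a map on the join-irreducibles only; the condition \<^const>\<open>extensional\<close> fixes its
  irrelevant values elsewhere, so that uniqueness has its intended meaning.
\<close>

definition pairing :: "'a::lattice set \<Rightarrow> ('a \<Rightarrow> 'a) \<Rightarrow> bool" where
  "pairing L \<kappa> \<longleftrightarrow>
     \<kappa> \<in> extensional (join_irreducibles L) \<and>
     bij_betw \<kappa> (join_irreducibles L) (meet_irreducibles L) \<and>
     (\<forall>j\<in>join_irreducibles L. \<kappa> j \<in> max_partners L j) \<and>
     (\<forall>m\<in>meet_irreducibles L. inv_into (join_irreducibles L) \<kappa> m \<in> min_partners L m)"

definition uniquely_paired :: "'a::lattice set \<Rightarrow> bool" where
  "uniquely_paired L \<longleftrightarrow> (\<exists>!\<kappa>. pairing L \<kappa>)"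

definition kappa :: "'a::lattice set \<Rightarrow> 'a \<Rightarrow> 'a" where
  "kappa L = (THE \<kappa>. pairing L \<kappa>)"

definition kappa_inv :: "'a::lattice set \<Rightarrow> 'a \<Rightarrow> 'a" where
  "kappa_inv L = inv_into (join_irreducibles L) (kappa L)"

definition prime_pair :: "'a::lattice set \<Rightarrow> 'a \<Rightarrow> 'a \<Rightarrow> bool" where
  "prime_pair L j\<^sub>0 m\<^sub>0 \<longleftrightarrow>
     j\<^sub>0 \<in> L \<and> m\<^sub>0 \<in> L \<and>
     L = (L \<inter> {..m\<^sub>0}) \<union> (L \<inter> {j\<^sub>0..}) \<and> (L \<inter> {..m\<^sub>0}) \<inter> (L \<inter> {j\<^sub>0..}) = {}"

inductive compatibly_dismantlable :: "'a::lattice set \<Rightarrow> bool" where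
  singleton:
    "uniquely_paired L \<Longrightarrow> card L = 1 \<Longrightarrow> compatibly_dismantlable L"
| dismantle:
    "uniquely_paired L \<Longrightarrow> prime_pair L j\<^sub>0 m\<^sub>0 \<Longrightarrow>
     compatibly_dismantlable (L \<inter> {j\<^sub>0..}) \<Longrightarrow>
     bij_betw (\<lambda>j. sup j\<^sub>0 j) {j \<in> join_irreducibles L. j\<^sub>0 \<le> kappa L j}
       (join_irreducibles (L \<inter> {j\<^sub>0..})) \<Longrightarrow>
     (\<forall>j\<in>join_irreducibles L. j\<^sub>0 \<le> kappa L j \<longrightarrow>
        kappa (L \<inter> {j\<^sub>0..}) (sup j\<^sub>0 j) = kappa L j) \<Longrightarrow>
     compatibly_dismantlable (L \<inter> {..m\<^sub>0}) \<Longrightarrow>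
     bij_betw (\<lambda>m. inf m\<^sub>0 m) {m \<in> meet_irreducibles L. kappa_inv L m \<le> m\<^sub>0}
       (meet_irreducibles (L \<inter> {..m\<^sub>0})) \<Longrightarrow>
     (\<forall>m\<in>meet_irreducibles L. kappa_inv L m \<le> m\<^sub>0 \<longrightarrow>
        kappa_inv (L \<inter> {..m\<^sub>0}) (inf m\<^sub>0 m) = kappa_inv L m) \<Longrightarrow>
     compatibly_dismantlable L"

definition galois_graph :: "'a::lattice set \<Rightarrow> ('a \<times> 'a) set" where
  "galois_graph L =
     {(j, j'). j \<in> join_irreducibles L \<and> j' \<in> join_irreducibles L \<and>
               j \<noteq> j' \<and> \<not> j \<le> kappa L j'}"

definition independent_set :: "('a \<times> 'a) set \<Rightarrow> 'a set \<Rightarrow> bool" where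
  "independent_set E S \<longleftrightarrow> (\<forall>j\<in>S. \<forall>j'\<in>S. (j, j') \<notin> E)"

definition join_irreducibles_below :: "'a::lattice set \<Rightarrow> 'a \<Rightarrow> 'a set" where
  "join_irreducibles_below L x = {j \<in> join_irreducibles L. j \<le> x}"

definition join_irreducibles_kappa_above :: "'a::lattice set \<Rightarrow> 'a \<Rightarrow> 'a set" where
  "join_irreducibles_kappa_above L x = {j \<in> join_irreducibles L. x \<le> kappa L j}"

text \<open>
  If \<^term>\<open>L\<close> is compatibly dismantlable and \<^term>\<open>x\<close> is covered by \<^term>\<open>y\<close>, then the set
  whose element is taken here is a singleton.
\<close>

definition edge_label :: "'a::lattice set \<Rightarrow> 'a \<Rightarrow> 'a \<Rightarrow> 'a" where
  "edge_label L x y =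
     the_elem (join_irreducibles_kappa_above L x \<inter> join_irreducibles_below L y)"

definition downward_labels :: "'a::lattice set \<Rightarrow> 'a \<Rightarrow> 'a set" where
  "downward_labels L x = {edge_label L y x | y. covered_by L y x}"

definition upward_labels :: "'a::lattice set \<Rightarrow> 'a \<Rightarrow> 'a set" where
  "upward_labels L x = {edge_label L x y | y. covered_by L x y}"

definition semidistrim :: "'a::lattice set \<Rightarrow> bool" where
  "semidistrim L \<longleftrightarrow>
     compatibly_dismantlable L \<and>
     (\<forall>x\<in>L. independent_set (galois_graph L) (downward_labels L x) \<and>
            independent_set (galois_graph L) (upward_labels L x))"

definition join_semidistributive :: "'a::lattice set \<Rightarrow> bool" where
  "join_semidistributive L \<longleftrightarrow>
     (\<forall>x\<in>L. \<forall>y\<in>L. \<forall>z\<in>L. sup x y = sup x z \<longrightarrow> sup x (inf y z) = sup x y)"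

definition meet_semidistributive :: "'a::lattice set \<Rightarrow> bool" where
  "meet_semidistributive L \<longleftrightarrow>
     (\<forall>x\<in>L. \<forall>y\<in>L. \<forall>z\<in>L. inf x y = inf x z \<longrightarrow> inf x (sup y z) = inf x y)"

definition semidistributive :: "'a::lattice set \<Rightarrow> bool" where
  "semidistributive L \<longleftrightarrow> join_semidistributive L \<and> meet_semidistributive L"

text \<open>
  The list \<^term>\<open>xs\<close> enumerates a chain \<open>x\<^sub>0, \<dots>, x\<^sub>n\<close> of length \<open>n\<close>, which has \<open>n + 1\<close>
  elements.
\<close>

definition extremal :: "'a::lattice set \<Rightarrow> bool" where
  "extremal L \<longleftrightarrow>
     (\<exists>xs n. set xs \<subseteq> L \<and> length xs = n + 1 \<and>
        (\<forall>z\<in>L. hd xs \<le> z) \<and> (\<forall>z\<in>L. z \<le> last xs) \<and> successively (covered_by L) xs \<and>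
        (\<forall>ys. set ys \<subseteq> L \<and> sorted_wrt (<) ys \<longrightarrow> length ys \<le> length xs) \<and>
        card (join_irreducibles L) = n \<and> card (meet_irreducibles L) = n)"

definition left_modular_element :: "'a::lattice set \<Rightarrow> 'a \<Rightarrow> bool" where
  "left_modular_element L x \<longleftrightarrow>
     x \<in> L \<and> (\<forall>y\<in>L. \<forall>z\<in>L. y \<le> z \<longrightarrow> inf (sup y x) z = sup y (inf x z))"

definition left_modular :: "'a::lattice set \<Rightarrow> bool" where
  "left_modular L \<longleftrightarrow>
     (\<exists>C. pred_on.maxchain L (<) C \<and> (\<forall>x\<in>C. left_modular_element L x))"

definition trim :: "'a::lattice set \<Rightarrow> bool" where
  "trim L \<longleftrightarrow> extremal L \<and> left_modular L"

end

theory Submission imports Defs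
begin

text \<open>
  Call a family of pairs \<open>j i\<close>, \<open>m i\<close> with \<open>j i \<nleq> m i\<close> a labelling if every cover \<open>x \<lessdot> y\<close> has exactly
  one index with \<open>j i \<le> y\<close> and \<open>x \<le> m i\<close>. A labelling restricts to any interval \<open>[a, b]\<close>: keep the
  indices with \<open>j i \<le> b\<close> and \<open>a \<le> m i\<close>, and replace the pairs by \<open>a \<squnion> j i\<close>, \<open>b \<sqinter> m i\<close>. Two conditions, both
  stable under this restriction, make a labelling the unique pairing and provide a prime pair:
  triangularity, \<open>j i \<le> m k\<close> for \<open>i < k\<close>, and splitting: if \<open>z \<le> j i \<squnion> m i\<close> or \<open>j i \<sqinter> m i \<le> z\<close> then
  \<open>z \<le> m i\<close> or \<open>j i \<le> z\<close>. Hence a lattice with such a labelling is compatibly dismantlable, by induction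
  on its size, and either condition also yields the independence of the label sets. A
  semidistributive lattice has a splitting labelling, with \<open>j\<close> minimal such that \<open>x \<squnion> j = y\<close> and \<open>m\<close>
  maximal such that \<open>y \<sqinter> m = x\<close> for each cover. A trim lattice has a triangular one, indexed by the
  steps of its left modular chain.
\<close>

section \<open>Finite lattices\<close>

lemma finite_sublatticeD:
  assumes "finite_sublattice L"
  shows "finite L" "L \<noteq> {}" "\<And>x y. x \<in> L \<Longrightarrow> y \<in> L \<Longrightarrow> inf x y \<in> L"
    "\<And>x y. x \<in> L \<Longrightarrow> y \<in> L \<Longrightarrow> sup x y \<in> L"
  using assms unfolding finite_sublattice_def by auto

section \<open>Covers in a finite lattice\<close>

lemma covered_byD:
  assumes "covered_by L x y"
  shows "x \<in> L" "y \<in> L" "x < y" "x \<le> y" "\<And>z. z \<in> L \<Longrightarrow> x \<le> z \<Longrightarrow> z \<le> y \<Longrightarrow> z = x \<or> z = y"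
  using assms unfolding covered_by_def by (auto simp: less_le)

lemma inf_less_left: "\<not> x \<le> y \<Longrightarrow> inf x y < (x::'a::lattice)"
  by (metis inf.cobounded1 inf.cobounded2 less_le)

lemma less_sup_left: "\<not> x \<le> y \<Longrightarrow> y < sup y (x::'a::lattice)"
  by (metis sup.cobounded1 sup.cobounded2 less_le)

lemma finite_minimalE:
  fixes S :: "'a::order set"
  assumes "finite S" "x \<in> S"
  obtains z where "z \<in> S" "\<And>w. w \<in> S \<Longrightarrow> \<not> w < z"
proof -
  obtain z where z: "z \<in> S" "\<forall>w\<in>S. w \<le> z \<longrightarrow> z = w"
    using finite_has_minimal[of S] assms by blast
  then have "\<not> w < z" if "w \<in> S" for w
    using that by (auto simp: less_le)
  then show ?thesis using that z by blast
qed

lemma finite_maximalE: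
  fixes S :: "'a::order set"
  assumes "finite S" "x \<in> S"
  obtains z where "z \<in> S" "\<And>w. w \<in> S \<Longrightarrow> \<not> z < w"
proof -
  obtain z where z: "z \<in> S" "\<forall>w\<in>S. z \<le> w \<longrightarrow> z = w"
    using finite_has_maximal[of S] assms by blast
  then have "\<not> z < w" if "w \<in> S" for w
    using that by (auto simp: less_le)
  then show ?thesis using that z by blast
qed

lemma ex_upper_cover:
  assumes "finite L" "x \<in> L" "y \<in> L" "x < y"
  shows "\<exists>z. covered_by L x z \<and> z \<le> y"
proof -
  let ?S = "{z \<in> L. x < z \<and> z \<le> y}"
  have "finite ?S" "y \<in> ?S" using assms by auto
  then obtain z where z: "z \<in> ?S" "\<And>w. w \<in> ?S \<Longrightarrow> \<not> w < z"
    by (rule finite_minimalE) blast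
  have "covered_by L x z"
    unfolding covered_by_def using z assms by (auto dest: less_imp_le order.trans)
  then show ?thesis using z by auto
qed

lemma ex_lower_cover:
  assumes "finite L" "x \<in> L" "y \<in> L" "x < y"
  shows "\<exists>z. covered_by L z y \<and> x \<le> z"
proof -
  let ?S = "{z \<in> L. x \<le> z \<and> z < y}"
  have "finite ?S" "x \<in> ?S" using assms by auto
  then obtain z where z: "z \<in> ?S" "\<And>w. w \<in> ?S \<Longrightarrow> \<not> z < w"
    by (rule finite_maximalE) blast
  have "covered_by L z y"
    unfolding covered_by_def using z assms by (auto dest: less_imp_le order.trans)
  then show ?thesis using z by auto
qed

lemma covered_by_sup_eq_iff:
  assumes "finite_sublattice L" "covered_by L x y" "z \<in> L" "z \<le> y"
  shows "sup x z = y \<longleftrightarrow> \<not> z \<le> x"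
proof -
  note c = covered_byD[OF assms(2)]
  have "sup x z = x \<or> sup x z = y"
    using c(4) c(5)[of "sup x z"] assms c(1) by (simp add: finite_sublatticeD)
  then show ?thesis using c(3) by (metis sup.cobounded2 sup.absorb1 less_irrefl)
qed

lemma covered_by_inf_eq_iff:
  assumes "finite_sublattice L" "covered_by L x y" "z \<in> L" "x \<le> z"
  shows "inf y z = x \<longleftrightarrow> \<not> y \<le> z"
proof -
  note c = covered_byD[OF assms(2)]
  have "inf y z = x \<or> inf y z = y"
    using c(4) c(5)[of "inf y z"] assms c(2) by (simp add: finite_sublatticeD)
  then show ?thesis using c(3) by (metis inf.cobounded2 inf.absorb1 less_irrefl)
qed

lemma sup_lower_covers:
  assumes "finite_sublattice L" "covered_by L y x" "covered_by L y' x" "y \<noteq> y'"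
  shows "sup y y' = x"
proof -
  note c = covered_byD[OF assms(2)] and c' = covered_byD[OF assms(3)]
  have "sup y y' \<in> L" using assms(1) c c' by (simp add: finite_sublatticeD)
  then have "sup y y' = y \<or> sup y y' = x" "sup y y' = y' \<or> sup y y' = x"
    using c c' by (metis sup.cobounded1 sup.cobounded2 sup.bounded_iff)+
  then show ?thesis using assms(4) by auto
qed

lemma inf_upper_covers:
  assumes "finite_sublattice L" "covered_by L x y" "covered_by L x y'" "y \<noteq> y'"
  shows "inf y y' = x"
proof -
  note c = covered_byD[OF assms(2)] and c' = covered_byD[OF assms(3)]
  have "inf y y' \<in> L" using assms(1) c c' by (simp add: finite_sublatticeD)
  then have "inf y y' = x \<or> inf y y' = y" "inf y y' = x \<or> inf y y' = y'"
    using c c' by (metis inf.cobounded1 inf.cobounded2 inf.bounded_iff)+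
  then show ?thesis using assms(4) by auto
qed

lemma ex_bottom:
  assumes "finite_sublattice L"
  shows "\<exists>a\<in>L. \<forall>z\<in>L. a \<le> z"
proof -
  obtain a where a: "a \<in> L" "\<And>z. z \<in> L \<Longrightarrow> z \<le> a \<Longrightarrow> a = z"
    using finite_has_minimal[of L] assms finite_sublatticeD by metis
  have "a \<le> z" if "z \<in> L" for z
    using a(2)[of "inf a z"] that a(1) assms by (metis finite_sublatticeD(3) inf.cobounded1 inf.cobounded2)
  then show ?thesis using a by auto
qed

lemma ex_top:
  assumes "finite_sublattice L"
  shows "\<exists>b\<in>L. \<forall>z\<in>L. z \<le> b"
proof -
  obtain a where a: "a \<in> L" "\<And>z. z \<in> L \<Longrightarrow> a \<le> z \<Longrightarrow> a = z"
    using finite_has_maximal[of L] assms finite_sublatticeD by metis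
  have "z \<le> a" if "z \<in> L" for z
    using a(2)[of "sup a z"] that a(1) assms by (metis finite_sublatticeD(4) sup.cobounded1 sup.cobounded2)
  then show ?thesis using a by auto
qed

section \<open>Join-irreducible and meet-irreducible elements\<close>

lemma join_irreducibleI:
  assumes "covered_by L p q" "\<And>z. z \<in> L \<Longrightarrow> z < q \<Longrightarrow> z \<le> p"
  shows "q \<in> join_irreducibles L" "lower_cover L q = p"
proof -
  have u: "x = p" if "covered_by L x q" for x
    using assms(2)[of x] covered_byD[OF that] covered_byD[OF assms(1)] by (metis less_le)
  show "q \<in> join_irreducibles L"
    unfolding join_irreducibles_def using assms(1) u covered_byD by blast
  show "lower_cover L q = p"
    unfolding lower_cover_def using assms(1) u by blast
qed

lemma meet_irreducibleI:
  assumes "covered_by L q p" "\<And>z. z \<in> L \<Longrightarrow> q < z \<Longrightarrow> p \<le> z"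
  shows "q \<in> meet_irreducibles L" "upper_cover L q = p"
proof -
  have u: "x = p" if "covered_by L q x" for x
    using assms(2)[of x] covered_byD[OF that] covered_byD[OF assms(1)] by (metis less_le)
  show "q \<in> meet_irreducibles L"
    unfolding meet_irreducibles_def using assms(1) u covered_byD by blast
  show "upper_cover L q = p"
    unfolding upper_cover_def using assms(1) u by blast
qed

lemma join_irreducibleE:
  assumes "finite L" "q \<in> join_irreducibles L"
  obtains p where "covered_by L p q" "\<And>z. z \<in> L \<Longrightarrow> z < q \<Longrightarrow> z \<le> p"
proof -
  obtain p where p: "covered_by L p q" "\<And>x. covered_by L x q \<Longrightarrow> x = p"
    using assms(2) unfolding join_irreducibles_def by blast
  then show ?thesis using that ex_lower_cover[OF assms(1)] covered_byD(2) by metis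
qed

lemma meet_irreducibleE:
  assumes "finite L" "q \<in> meet_irreducibles L"
  obtains p where "covered_by L q p" "\<And>z. z \<in> L \<Longrightarrow> q < z \<Longrightarrow> p \<le> z"
proof -
  obtain p where p: "covered_by L q p" "\<And>x. covered_by L q x \<Longrightarrow> x = p"
    using assms(2) unfolding meet_irreducibles_def by blast
  then show ?thesis using that ex_upper_cover[OF assms(1)] covered_byD(1) by metis
qed

text \<open>A minimal element \<open>q\<close> of \<open>?S\<close> works: everything strictly below
  \<open>q\<close> lies below \<open>y\<close>, and so do joins of such elements, which therefore
  never reach \<open>q\<close>.\<close>

lemma ex_join_irreducible:
  assumes "finite_sublattice L" "x \<in> L" "y \<in> L" "\<not> x \<le> y"
  shows "\<exists>q\<in>join_irreducibles L. q \<le> x \<and> \<not> q \<le> y"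
proof -
  note fs = finite_sublatticeD[OF assms(1)]
  let ?S = "{z \<in> L. z \<le> x \<and> \<not> z \<le> y}"
  have "finite ?S" "x \<in> ?S" using assms fs by auto
  then obtain q where q: "q \<in> ?S" "\<And>w. w \<in> ?S \<Longrightarrow> \<not> w < q"
    by (rule finite_minimalE) blast
  have below: "z \<le> y" if "z \<in> L" "z < q" for z
    using q(1) q(2)[of z] that by (auto dest: less_imp_le order.trans)
  have "inf q y \<in> L" "inf q y < q" using fs q assms by (auto intro: inf_less_left)
  then obtain p where p: "covered_by L p q" using ex_lower_cover fs(1) q by blast
  have "z \<le> p" if z: "z \<in> L" "z < q" for z
  proof -
    have "sup z p \<le> y" using below[of z] below[of p] z covered_byD[OF p] by simp
    then have "sup z p \<noteq> q" "sup z p \<le> q" using q z covered_byD[OF p] by (auto dest: less_imp_le)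
    then have "sup z p = p" using covered_byD[OF p] fs z by (metis sup.cobounded2)
    then show ?thesis by (metis sup.cobounded1)
  qed
  from join_irreducibleI(1)[OF p this] show ?thesis using q by auto
qed

lemma ex_meet_irreducible:
  assumes "finite_sublattice L" "x \<in> L" "y \<in> L" "\<not> x \<le> y"
  shows "\<exists>q\<in>meet_irreducibles L. y \<le> q \<and> \<not> x \<le> q"
proof -
  note fs = finite_sublatticeD[OF assms(1)]
  let ?S = "{z \<in> L. y \<le> z \<and> \<not> x \<le> z}"
  have "finite ?S" "y \<in> ?S" using assms fs by auto
  then obtain q where q: "q \<in> ?S" "\<And>w. w \<in> ?S \<Longrightarrow> \<not> q < w"
    by (rule finite_maximalE) blast
  have above: "x \<le> z" if "z \<in> L" "q < z" for z
    using q(1) q(2)[of z] that by (auto dest: less_imp_le order.trans)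
  have "sup q x \<in> L" "q < sup q x" using fs q assms by (auto intro: less_sup_left)
  then obtain p where p: "covered_by L q p" using ex_upper_cover fs(1) q by blast
  have "p \<le> z" if z: "z \<in> L" "q < z" for z
  proof -
    have "x \<le> inf z p" using above[of z] above[of p] z covered_byD[OF p] by simp
    then have "inf z p \<noteq> q" "q \<le> inf z p" using q z covered_byD[OF p] by (auto dest: less_imp_le)
    then have "inf z p = p" using covered_byD[OF p] fs z by (metis inf.cobounded2)
    then show ?thesis by (metis inf.cobounded1)
  qed
  from meet_irreducibleI(1)[OF p this] show ?thesis using q by auto
qed

section \<open>Intervals as lattices of their own\<close>

lemma finite_sublattice_interval:
  assumes "finite_sublattice L" "a \<in> L" "a \<le> b"
  shows "finite_sublattice (L \<inter> {a..b})"
  using assms unfolding finite_sublattice_def by (auto intro: le_infI1 le_supI1)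

text \<open>Intervals are convex, so no element strictly between \<open>x\<close> and
  \<open>y\<close> is lost.\<close>

lemma covered_by_interval:
  "covered_by (L \<inter> {a..b}) x y \<longleftrightarrow> covered_by L x y \<and> a \<le> x \<and> y \<le> b"
proof (cases "a \<le> x \<and> x < y \<and> y \<le> b")
  case True
  then have "z \<in> {a..b}" if "x < z" "z < y" for z
    using that by (auto dest: less_imp_le)
  then have "(\<exists>z\<in>L \<inter> {a..b}. x < z \<and> z < y) \<longleftrightarrow> (\<exists>z\<in>L. x < z \<and> z < y)"
    by blast
  moreover have "x \<in> {a..b}" "y \<in> {a..b}" using True by auto
  ultimately show ?thesis unfolding covered_by_def using True by blast
next
  case False
  then show ?thesis unfolding covered_by_def by (meson Int_iff atLeastAtMost_iff)
qed

section \<open>Labellings of covers\<close>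

text \<open>Indices are kept apart from the elements because restriction to an interval changes the
  pairs \<open>j i\<close>, \<open>m i\<close> but only shrinks the index set.\<close>

definition labelling :: "'a::lattice set \<Rightarrow> 'i set \<Rightarrow> ('i \<Rightarrow> 'a) \<Rightarrow> ('i \<Rightarrow> 'a) \<Rightarrow> bool" where
  "labelling L I j m \<longleftrightarrow>
     finite_sublattice L \<and> (\<forall>i\<in>I. j i \<in> L \<and> m i \<in> L \<and> \<not> j i \<le> m i) \<and>
     (\<forall>x y. covered_by L x y \<longrightarrow> (\<exists>!i. i \<in> I \<and> j i \<le> y \<and> x \<le> m i))"

text \<open>The common consequence of splitting and triangularity: \<open>j i\<close> is minimal
  among the elements not below \<open>m i\<close>, and \<open>m i\<close> is maximal among those not
  above \<open>j i\<close>. This makes both irreducible.\<close>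

definition tight_labelling :: "'a::lattice set \<Rightarrow> 'i set \<Rightarrow> ('i \<Rightarrow> 'a) \<Rightarrow> ('i \<Rightarrow> 'a) \<Rightarrow> bool" where
  "tight_labelling L I j m \<longleftrightarrow> labelling L I j m \<and>
     (\<forall>i\<in>I. \<forall>z\<in>L. (z < j i \<longrightarrow> z \<le> m i) \<and> (m i < z \<longrightarrow> j i \<le> z))"

lemma labellingD:
  assumes "labelling L I j m"
  shows "finite_sublattice L" "\<And>i. i \<in> I \<Longrightarrow> j i \<in> L" "\<And>i. i \<in> I \<Longrightarrow> m i \<in> L"
    "\<And>i. i \<in> I \<Longrightarrow> \<not> j i \<le> m i"
    "\<And>x y. covered_by L x y \<Longrightarrow> \<exists>i\<in>I. j i \<le> y \<and> x \<le> m i"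
    "\<And>x y i k. covered_by L x y \<Longrightarrow> i \<in> I \<Longrightarrow> j i \<le> y \<Longrightarrow> x \<le> m i \<Longrightarrow>
      k \<in> I \<Longrightarrow> j k \<le> y \<Longrightarrow> x \<le> m k \<Longrightarrow> i = k"
  using assms unfolding labelling_def by (blast | metis)+

lemma labelling_cover:
  assumes "labelling L I j m" "covered_by L x y" "i \<in> I" "j i \<le> y" "x \<le> m i"
  shows "sup x (j i) = y" "inf y (m i) = x" "\<not> j i \<le> x" "\<not> y \<le> m i"
proof -
  note l = labellingD[OF assms(1)] and c = covered_byD[OF assms(2)]
  note fs = finite_sublatticeD[OF l(1)]
  show n: "\<not> j i \<le> x" "\<not> y \<le> m i" using assms l(4) by (meson order.trans)+
  have "sup x (j i) \<in> L" "inf y (m i) \<in> L" using l fs c assms by auto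
  then show "sup x (j i) = y" "inf y (m i) = x"
    using c n assms by (metis sup.cobounded1 sup.cobounded2 sup.bounded_iff,
      metis inf.cobounded1 inf.cobounded2 inf.bounded_iff)
qed

text \<open>A cover of the interval is a cover of \<open>L\<close> between \<open>a\<close> and
  \<open>b\<close>. For such a cover, the label conditions on the new pairs and indices are
  equivalent to those on the old ones.\<close>

lemma labelling_interval:
  assumes "labelling L I j m" "a \<in> L" "b \<in> L" "a \<le> b"
  shows "labelling (L \<inter> {a..b}) {i \<in> I. j i \<le> b \<and> a \<le> m i} (\<lambda>i. sup a (j i)) (\<lambda>i. inf b (m i))"
proof -
  note l = labellingD[OF assms(1)]
  note fs = finite_sublatticeD[OF l(1)]
  have "\<exists>!i. i \<in> {i \<in> I. j i \<le> b \<and> a \<le> m i} \<and> sup a (j i) \<le> y \<and> x \<le> inf b (m i)"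
    if "covered_by (L \<inter> {a..b}) x y" for x y
  proof -
    have c: "covered_by L x y" "a \<le> x" "y \<le> b" using that covered_by_interval by blast+
    then have "x \<le> b" "a \<le> y" using covered_byD[OF c(1)] by auto
    have "i \<in> {i \<in> I. j i \<le> b \<and> a \<le> m i} \<and> sup a (j i) \<le> y \<and> x \<le> inf b (m i) \<longleftrightarrow>
          i \<in> I \<and> j i \<le> y \<and> x \<le> m i" for i
      using c \<open>x \<le> b\<close> \<open>a \<le> y\<close> by auto
    then show ?thesis using assms(1) c(1) unfolding labelling_def by simp
  qed
  moreover have "\<not> sup a (j i) \<le> inf b (m i)" if "i \<in> I" for i
    using l(4)[OF that] by auto
  ultimately show ?thesis
    unfolding labelling_def using finite_sublattice_interval[OF l(1) assms(2,4)] l fs assms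
    by (auto intro: le_supI1 le_infI1)
qed

text \<open>By tightness \<open>inf (j i) (m i)\<close> is the greatest element strictly below
  \<open>j i\<close>, and \<open>sup (m i) (j i)\<close> the least strictly above
  \<open>m i\<close>.\<close>

lemma tight_labelling_covers:
  assumes "tight_labelling L I j m" "i \<in> I"
  shows "covered_by L (inf (j i) (m i)) (j i)" "covered_by L (m i) (sup (m i) (j i))"
    "j i \<in> join_irreducibles L" "lower_cover L (j i) = inf (j i) (m i)"
    "m i \<in> meet_irreducibles L" "upper_cover L (m i) = sup (m i) (j i)"
proof -
  have lab: "labelling L I j m" and t: "\<And>z. z \<in> L \<Longrightarrow> z < j i \<Longrightarrow> z \<le> m i"
    "\<And>z. z \<in> L \<Longrightarrow> m i < z \<Longrightarrow> j i \<le> z"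
    using assms unfolding tight_labelling_def by auto
  note l = labellingD(2-4)[OF lab assms(2)] and fs = finite_sublatticeD[OF labellingD(1)[OF lab]]
  have lt: "inf (j i) (m i) < j i" "m i < sup (m i) (j i)"
    using l by (auto intro: inf_less_left less_sup_left)
  have jl: "z \<le> inf (j i) (m i)" if "z \<in> L" "z < j i" for z using t that by auto
  have mu: "sup (m i) (j i) \<le> z" if "z \<in> L" "m i < z" for z using t that by auto
  show cj: "covered_by L (inf (j i) (m i)) (j i)"
    unfolding covered_by_def using l fs lt jl leD by blast
  show cm: "covered_by L (m i) (sup (m i) (j i))"
    unfolding covered_by_def using l fs lt mu leD by blast
  show "j i \<in> join_irreducibles L" "lower_cover L (j i) = inf (j i) (m i)"
    using join_irreducibleI[OF cj jl] by auto
  show "m i \<in> meet_irreducibles L" "upper_cover L (m i) = sup (m i) (j i)"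
    using meet_irreducibleI[OF cm mu] by auto
qed

text \<open>If \<open>j i = j k\<close>, both indices label the cover below \<open>j i\<close>, so
  they agree. Every join-irreducible \<open>q\<close> is reached by the index of its lower cover:
  \<open>j i\<close> is below \<open>q\<close> but not below \<open>p\<close>, while all elements
  strictly below \<open>q\<close> are below \<open>p\<close>. The argument for \<open>m\<close> is
  dual.\<close>

lemma tight_labelling_bij:
  assumes "tight_labelling L I j m"
  shows "bij_betw j I (join_irreducibles L)" "bij_betw m I (meet_irreducibles L)"
proof -
  have lab: "labelling L I j m" using assms unfolding tight_labelling_def by auto
  note l = labellingD[OF lab] and t = tight_labelling_covers[OF assms]
  note fin = finite_sublatticeD(1)[OF l(1)]
  have "i = k" if "i \<in> I" "k \<in> I" "j i = j k" for i k
    using l(6)[OF t(1)[OF that(1)], of i k] t(4) that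
    by (metis inf.cobounded2 order.refl)
  moreover have "q \<in> j ` I" if q: "q \<in> join_irreducibles L" for q
  proof -
    obtain p where p: "covered_by L p q" "\<And>z. z \<in> L \<Longrightarrow> z < q \<Longrightarrow> z \<le> p"
      using join_irreducibleE[OF fin q] by metis
    then obtain i where i: "i \<in> I" "j i \<le> q" "p \<le> m i" using l(5) by blast
    then have "j i = q"
      using p(2)[of "j i"] labelling_cover(3)[OF lab p(1) i] l(2) by (auto simp: less_le)
    then show ?thesis using i by auto
  qed
  ultimately show "bij_betw j I (join_irreducibles L)"
    unfolding bij_betw_def inj_on_def using t(3) by blast
  have "i = k" if "i \<in> I" "k \<in> I" "m i = m k" for i k
    using l(6)[OF t(2)[OF that(1)], of i k] t(6) that
    by (metis sup.cobounded2 order.refl)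
  moreover have "q \<in> m ` I" if q: "q \<in> meet_irreducibles L" for q
  proof -
    obtain p where p: "covered_by L q p" "\<And>z. z \<in> L \<Longrightarrow> q < z \<Longrightarrow> p \<le> z"
      using meet_irreducibleE[OF fin q] by metis
    then obtain i where i: "i \<in> I" "j i \<le> p" "q \<le> m i" using l(5) by blast
    then have "m i = q"
      using p(2)[of "m i"] labelling_cover(4)[OF lab p(1) i] l(3) by (auto simp: less_le)
    then show ?thesis using i by auto
  qed
  ultimately show "bij_betw m I (meet_irreducibles L)"
    unfolding bij_betw_def inj_on_def using t(5) by blast
qed

text \<open>Collects what compatible dismantlability asks about irreducibles and the pairing. In
  terms of indices, the maps \<alpha> and \<beta> of that notion keep the index.\<close>

definition paired_by :: "'a::lattice set \<Rightarrow> 'i set \<Rightarrow> ('i \<Rightarrow> 'a) \<Rightarrow> ('i \<Rightarrow> 'a) \<Rightarrow> bool" where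
  "paired_by L I j m \<longleftrightarrow>
     bij_betw j I (join_irreducibles L) \<and> bij_betw m I (meet_irreducibles L) \<and>
     uniquely_paired L \<and> (\<forall>i\<in>I. kappa L (j i) = m i \<and> kappa_inv L (m i) = j i)"

lemma pairing_of_tight_labelling:
  assumes "tight_labelling L I j m"
  shows "\<exists>\<kappa>. pairing L \<kappa> \<and> (\<forall>i\<in>I. \<kappa> (j i) = m i)"
proof -
  have lab: "labelling L I j m" using assms unfolding tight_labelling_def by auto
  note l = labellingD[OF lab] and t = tight_labelling_covers[OF assms]
  note b = tight_labelling_bij[OF assms]
  \<comment> \<open>Going through the index sends \<open>j i\<close> to \<open>m i\<close>;
    \<open>restrict\<close> supplies the extensionality that a pairing demands.\<close>
  define \<kappa> where "\<kappa> = restrict (m \<circ> inv_into I j) (join_irreducibles L)"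
  have \<kappa>: "\<kappa> (j i) = m i" if "i \<in> I" for i
    using that t(3) b(1) by (simp add: \<kappa>_def bij_betw_def inv_into_f_f)
  have bij: "bij_betw \<kappa> (join_irreducibles L) (meet_irreducibles L)"
    using bij_betw_trans[OF bij_betw_inv_into[OF b(1)] b(2)] unfolding \<kappa>_def
    by (simp cong: bij_betw_cong)
  have inv: "inv_into (join_irreducibles L) \<kappa> (m i) = j i" if "i \<in> I" for i
    using bij t(3)[OF that] \<kappa>[OF that] by (metis bij_betw_def inv_into_f_f)
  have max: "m i \<in> max_partners L (j i)" if i: "i \<in> I" for i
  proof -
    \<comment> \<open>Above \<open>m i\<close> the meet with \<open>j i\<close> jumps to
      \<open>j i\<close>, so \<open>m i\<close> is maximal among the candidates.\<close>
    have "inf (j i) z \<noteq> inf (j i) (m i)" if "z \<in> L" "m i < z" for z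
    proof -
      have "j i \<le> z" using assms i that unfolding tight_labelling_def by auto
      then show ?thesis using l(4)[OF i] by (metis inf.absorb1 inf.cobounded2)
    qed
    then show ?thesis
      unfolding max_partners_def maximal_elements_def by (simp add: l(3)[OF i] t(4)[OF i]) metis
  qed
  have min: "j i \<in> min_partners L (m i)" if i: "i \<in> I" for i
  proof -
    have "sup (m i) z \<noteq> sup (m i) (j i)" if "z \<in> L" "z < j i" for z
    proof -
      have "z \<le> m i" using assms i that unfolding tight_labelling_def by auto
      then show ?thesis using l(4)[OF i] by (metis sup.absorb1 sup.cobounded2)
    qed
    then show ?thesis
      unfolding min_partners_def minimal_elements_def by (simp add: l(2)[OF i] t(6)[OF i]) metis
  qed
  have J: "join_irreducibles L = j ` I" and M: "meet_irreducibles L = m ` I"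
    using b by (auto simp: bij_betw_def)
  have "\<forall>q\<in>join_irreducibles L. \<kappa> q \<in> max_partners L q"
    using max \<kappa> by (simp add: J)
  moreover have "\<forall>q\<in>meet_irreducibles L. inv_into (join_irreducibles L) \<kappa> q \<in> min_partners L q"
    using min inv by (simp add: M)
  moreover have "\<kappa> \<in> extensional (join_irreducibles L)" by (simp add: \<kappa>_def)
  ultimately have "pairing L \<kappa>" unfolding pairing_def using bij by blast
  then show ?thesis using \<kappa> by blast
qed

text \<open>Every join-irreducible is some \<open>j i\<close>, and extensionality fixes a pairing
  elsewhere, so agreement on the \<open>j i\<close> is uniqueness.\<close>

lemma paired_byI:
  assumes t: "tight_labelling L I j m"
    and u: "\<And>\<kappa> i. pairing L \<kappa> \<Longrightarrow> i \<in> I \<Longrightarrow> \<kappa> (j i) = m i"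
  shows "paired_by L I j m"
proof -
  note b = tight_labelling_bij[OF t]
  obtain \<kappa> where \<kappa>: "pairing L \<kappa>" using pairing_of_tight_labelling[OF t] by blast
  have uniq: "\<kappa>' = \<kappa>" if \<kappa>': "pairing L \<kappa>'" for \<kappa>'
  proof (rule extensionalityI[of _ "join_irreducibles L"])
    show "\<kappa>' \<in> extensional (join_irreducibles L)" "\<kappa> \<in> extensional (join_irreducibles L)"
      using \<kappa> \<kappa>' unfolding pairing_def by blast+
    fix q assume "q \<in> join_irreducibles L"
    then obtain i where "i \<in> I" "q = j i" using b(1) by (auto simp: bij_betw_def)
    then show "\<kappa>' q = \<kappa> q" using u[OF \<kappa>] u[OF \<kappa>'] by simp
  qed
  then have up: "uniquely_paired L" unfolding uniquely_paired_def using \<kappa> by blast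
  have k: "kappa L = \<kappa>" unfolding kappa_def using \<kappa> uniq by blast
  have "kappa_inv L (m i) = j i" if "i \<in> I" for i
  proof -
    have "inj_on \<kappa> (join_irreducibles L)" "j i \<in> join_irreducibles L"
      using \<kappa> b(1) that by (auto simp: pairing_def bij_betw_def)
    then show ?thesis
      unfolding kappa_inv_def k using u[OF \<kappa> that] by (metis inv_into_f_f)
  qed
  then show ?thesis unfolding paired_by_def using b up k u[OF \<kappa>] by auto
qed

section \<open>From paired labellings to dismantlings and independent label sets\<close>

lemma compatibly_dismantlable_step:
  assumes L: "paired_by L I j m" and pp: "prime_pair L j\<^sub>0 m\<^sub>0"
    and U: "paired_by (L \<inter> {j\<^sub>0..}) {i \<in> I. j\<^sub>0 \<le> m i} (\<lambda>i. sup j\<^sub>0 (j i)) m"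
    and D: "paired_by (L \<inter> {..m\<^sub>0}) {i \<in> I. j i \<le> m\<^sub>0} j (\<lambda>i. inf m\<^sub>0 (m i))"
    and cU: "compatibly_dismantlable (L \<inter> {j\<^sub>0..})"
    and cD: "compatibly_dismantlable (L \<inter> {..m\<^sub>0})"
  shows "compatibly_dismantlable L"
proof (rule compatibly_dismantlable.dismantle[OF _ pp cU _ _ cD])
  note d = L[unfolded paired_by_def] U[unfolded paired_by_def] D[unfolded paired_by_def]
  have J: "join_irreducibles L = j ` I" and M: "meet_irreducibles L = m ` I"
    and inj: "inj_on j I" "inj_on m I"
    using d(1) by (auto simp: bij_betw_def)
  have k: "kappa L (j i) = m i" "kappa_inv L (m i) = j i" if "i \<in> I" for i
    using d(1) that by auto
  show "uniquely_paired L" using d(1) by blast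
  have JU: "{q \<in> join_irreducibles L. j\<^sub>0 \<le> kappa L q} = j ` {i \<in> I. j\<^sub>0 \<le> m i}"
    using k by (auto simp: J)
  have MD: "{q \<in> meet_irreducibles L. kappa_inv L q \<le> m\<^sub>0} = m ` {i \<in> I. j i \<le> m\<^sub>0}"
    using k by (auto simp: M)
  \<comment> \<open>Both this map and its composite with \<open>sup j\<^sub>0\<close> are bijections
    from the indices (the composite by \<open>U\<close>), hence so is \<open>sup j\<^sub>0\<close>
    between the images. The lower half is treated dually.\<close>
  have "bij_betw j {i \<in> I. j\<^sub>0 \<le> m i} (j ` {i \<in> I. j\<^sub>0 \<le> m i})"
    using inj by (auto intro: inj_on_imp_bij_betw inj_on_subset)
  from bij_betw_comp_iff[OF this]
  show "bij_betw (sup j\<^sub>0) {q \<in> join_irreducibles L. j\<^sub>0 \<le> kappa L q} (join_irreducibles (L \<inter> {j\<^sub>0..}))"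
    unfolding JU using d(2) by (auto simp: comp_def)
  have "bij_betw m {i \<in> I. j i \<le> m\<^sub>0} (m ` {i \<in> I. j i \<le> m\<^sub>0})"
    using inj by (auto intro: inj_on_imp_bij_betw inj_on_subset)
  from bij_betw_comp_iff[OF this]
  show "bij_betw (inf m\<^sub>0) {q \<in> meet_irreducibles L. kappa_inv L q \<le> m\<^sub>0} (meet_irreducibles (L \<inter> {..m\<^sub>0}))"
    unfolding MD using d(3) by (auto simp: comp_def)
  show "\<forall>q\<in>join_irreducibles L. j\<^sub>0 \<le> kappa L q \<longrightarrow> kappa (L \<inter> {j\<^sub>0..}) (sup j\<^sub>0 q) = kappa L q"
    using d(2) k by (auto simp: J)
  show "\<forall>q\<in>meet_irreducibles L. kappa_inv L q \<le> m\<^sub>0 \<longrightarrow>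
    kappa_inv (L \<inter> {..m\<^sub>0}) (inf m\<^sub>0 q) = kappa_inv L q"
    using d(3) k by (auto simp: M)
qed

lemma paired_by_cong:
  assumes "\<And>i. i \<in> I \<Longrightarrow> j i = j' i" "\<And>i. i \<in> I \<Longrightarrow> m i = m' i"
  shows "paired_by L I j m \<longleftrightarrow> paired_by L I j' m'"
  unfolding paired_by_def using assms bij_betw_cong[of I j j'] bij_betw_cong[of I m m'] by auto

text \<open>The induction shared by both kinds of lattice: \<open>C\<close> stands for splitting or
  triangular labellings, and closure under intervals lets the induction hypothesis apply to both
  halves. The premise \<open>x < y\<close> of \<open>prime\<close> excludes the one-element lattice,
  which has no index.\<close>

lemma compatibly_dismantlable_of_class:
  fixes C :: "'a::lattice set \<Rightarrow> 'i set \<Rightarrow> ('i \<Rightarrow> 'a) \<Rightarrow> ('i \<Rightarrow> 'a) \<Rightarrow> bool"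
  assumes lab: "\<And>L I j m. C L I j m \<Longrightarrow> labelling L I j m"
    and paired: "\<And>L I j m. C L I j m \<Longrightarrow> paired_by L I j m"
    and int: "\<And>L I j m a b. C L I j m \<Longrightarrow> a \<in> L \<Longrightarrow> b \<in> L \<Longrightarrow> a \<le> b \<Longrightarrow>
      C (L \<inter> {a..b}) {i \<in> I. j i \<le> b \<and> a \<le> m i} (\<lambda>i. sup a (j i)) (\<lambda>i. inf b (m i))"
    and prime: "\<And>L I j m x y. C L I j m \<Longrightarrow> x \<in> L \<Longrightarrow> y \<in> L \<Longrightarrow> x < y \<Longrightarrow>
      \<exists>i\<in>I. \<forall>z\<in>L. z \<le> m i \<or> j i \<le> z"
    and "C L I j m"
  shows "compatibly_dismantlable L"
  using \<open>C L I j m\<close>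
proof (induction "card L" arbitrary: L I j m rule: less_induct)
  case less
  note C = less.prems
  note l = labellingD[OF lab[OF C]]
  note fs = finite_sublatticeD[OF l(1)]
  obtain a where a: "a \<in> L" "\<And>z. z \<in> L \<Longrightarrow> a \<le> z" using ex_bottom[OF l(1)] by blast
  obtain b where b: "b \<in> L" "\<And>z. z \<in> L \<Longrightarrow> z \<le> b" using ex_top[OF l(1)] by blast
  show ?case
  proof (cases "a = b")
    case True
    then have "L = {a}" using a b by (auto intro: order.antisym)
    then have "card L = 1" by simp
    moreover have "uniquely_paired L" using paired[OF C] unfolding paired_by_def by blast
    ultimately show ?thesis by (blast intro: compatibly_dismantlable.singleton)
  next
    case False
    then have "a < b" using a(2)[OF b(1)] by simp
    then obtain i where i: "i \<in> I" and pr: "\<And>z. z \<in> L \<Longrightarrow> z \<le> m i \<or> j i \<le> z"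
      using prime[OF C a(1) b(1)] by blast
    note i' = l(2-4)[OF i]
    have pp: "prime_pair L (j i) (m i)"
      unfolding prime_pair_def using i' pr by (auto dest: order.trans)
    \<comment> \<open>With the top \<open>b\<close> and the bottom \<open>a\<close> as second
      endpoints, the two halves become intervals as in \<open>int\<close>. The operations
      \<open>inf b\<close> and \<open>sup a\<close> then disappear again.\<close>
    have Ueq: "L \<inter> {j i..b} = L \<inter> {j i..}" and Deq: "L \<inter> {a..m i} = L \<inter> {..m i}"
      using a b by auto
    have IU: "{k \<in> I. j k \<le> b \<and> j i \<le> m k} = {k \<in> I. j i \<le> m k}"
      and ID: "{k \<in> I. j k \<le> m i \<and> a \<le> m k} = {k \<in> I. j k \<le> m i}"
      using a b l by auto
    have CU: "C (L \<inter> {j i..}) {k \<in> I. j i \<le> m k} (\<lambda>k. sup (j i) (j k)) (\<lambda>k. inf b (m k))"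
      using int[OF C i'(1) b(1) b(2)[OF i'(1)]] unfolding Ueq IU .
    have CD: "C (L \<inter> {..m i}) {k \<in> I. j k \<le> m i} (\<lambda>k. sup a (j k)) (\<lambda>k. inf (m i) (m k))"
      using int[OF C a(1) i'(2) a(2)[OF i'(2)]] unfolding Deq ID .
    have "paired_by (L \<inter> {j i..}) {k \<in> I. j i \<le> m k} (\<lambda>k. sup (j i) (j k)) m"
      using paired[OF CU] paired_by_cong[of "{k \<in> I. j i \<le> m k}" "\<lambda>k. sup (j i) (j k)" "\<lambda>k. sup (j i) (j k)"
        "\<lambda>k. inf b (m k)" m] l b by (simp add: inf.absorb2)
    moreover have "paired_by (L \<inter> {..m i}) {k \<in> I. j k \<le> m i} j (\<lambda>k. inf (m i) (m k))"
      using paired[OF CD] paired_by_cong[of "{k \<in> I. j k \<le> m i}" "\<lambda>k. sup a (j k)" j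
        "\<lambda>k. inf (m i) (m k)" "\<lambda>k. inf (m i) (m k)"] l a by (simp add: sup.absorb2)
    \<comment> \<open>The upper half misses \<open>m i\<close> and the lower half misses
      \<open>j i\<close>.\<close>
    moreover have "card (L \<inter> {j i..}) < card L" "card (L \<inter> {..m i}) < card L"
      using i' fs(1) by (auto intro!: psubset_card_mono)
    ultimately show ?thesis
      using compatibly_dismantlable_step[OF paired[OF C] pp] less.hyps CU CD by blast
  qed
qed

text \<open>The label of a cover is \<open>j i\<close> for its unique index \<open>i\<close>, and
  \<kappa> takes \<open>j k\<close> to \<open>m k\<close>. So an edge from \<open>j i\<close> to
  \<open>j k\<close> means that \<open>j i \<le> m k\<close> fails, which \<open>down\<close> and
  \<open>up\<close> exclude.\<close>

lemma semidistrimI: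
  assumes cd: "compatibly_dismantlable L" and p: "paired_by L I j m" and lab: "labelling L I j m"
    and down: "\<And>x y y' i k. covered_by L y x \<Longrightarrow> covered_by L y' x \<Longrightarrow> y \<noteq> y' \<Longrightarrow>
      i \<in> I \<Longrightarrow> j i \<le> x \<Longrightarrow> y \<le> m i \<Longrightarrow> k \<in> I \<Longrightarrow> j k \<le> x \<Longrightarrow> y' \<le> m k \<Longrightarrow> j i \<le> m k"
    and up: "\<And>x y y' i k. covered_by L x y \<Longrightarrow> covered_by L x y' \<Longrightarrow> y \<noteq> y' \<Longrightarrow>
      i \<in> I \<Longrightarrow> j i \<le> y \<Longrightarrow> x \<le> m i \<Longrightarrow> k \<in> I \<Longrightarrow> j k \<le> y' \<Longrightarrow> x \<le> m k \<Longrightarrow> j i \<le> m k"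
  shows "semidistrim L"
proof -
  note l = labellingD[OF lab]
  have J: "join_irreducibles L = j ` I" and inj: "inj_on j I"
    and k: "\<And>i. i \<in> I \<Longrightarrow> kappa L (j i) = m i"
    using p by (auto simp: paired_by_def bij_betw_def)
  have e: "\<exists>i\<in>I. j i \<le> y \<and> x \<le> m i \<and> edge_label L x y = j i" if c: "covered_by L x y" for x y
  proof -
    obtain i where i: "i \<in> I" "j i \<le> y" "x \<le> m i" using l(5)[OF c] by blast
    then have "{k \<in> I. j k \<le> y \<and> x \<le> m k} = {i}" using l(6)[OF c] by blast
    moreover have "join_irreducibles_kappa_above L x \<inter> join_irreducibles_below L y =
        j ` {k \<in> I. j k \<le> y \<and> x \<le> m k}"
      unfolding join_irreducibles_kappa_above_def join_irreducibles_below_def J using k by auto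
    ultimately have "join_irreducibles_kappa_above L x \<inter> join_irreducibles_below L y = {j i}"
      by simp
    then show ?thesis using i unfolding edge_label_def by auto
  qed
  have "independent_set (galois_graph L) (downward_labels L x)" for x
    unfolding independent_set_def galois_graph_def
  proof clarify
    fix q q' assume q: "q \<in> downward_labels L x" "q' \<in> downward_labels L x"
      and ne: "q \<noteq> q'" and nle: "\<not> q \<le> kappa L q'"
    then obtain y y' where c: "covered_by L y x" "q = edge_label L y x"
      "covered_by L y' x" "q' = edge_label L y' x"
      unfolding downward_labels_def by blast
    then obtain i i' where "i \<in> I" "j i \<le> x" "y \<le> m i" "q = j i"
      "i' \<in> I" "j i' \<le> x" "y' \<le> m i'" "q' = j i'" using e by metis
    then show False using down[OF c(1,3)] c ne nle k by metis
  qed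
  moreover have "independent_set (galois_graph L) (upward_labels L x)" for x
    unfolding independent_set_def galois_graph_def
  proof clarify
    fix q q' assume q: "q \<in> upward_labels L x" "q' \<in> upward_labels L x"
      and ne: "q \<noteq> q'" and nle: "\<not> q \<le> kappa L q'"
    then obtain y y' where c: "covered_by L x y" "q = edge_label L x y"
      "covered_by L x y'" "q' = edge_label L x y'"
      unfolding upward_labels_def by blast
    then obtain i i' where "i \<in> I" "j i \<le> y" "x \<le> m i" "q = j i"
      "i' \<in> I" "j i' \<le> y'" "x \<le> m i'" "q' = j i'" using e by metis
    then show False using up[OF c(1,3)] c ne nle k by metis
  qed
  ultimately show ?thesis unfolding semidistrim_def using cd by blast
qed

section \<open>Semidistributive lattices\<close>

text \<open>On the elements below \<open>sup (j i) (m i)\<close>, and on those above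
  \<open>inf (j i) (m i)\<close>, the pair divides as a prime pair would.\<close>

definition splitting_labelling ::
    "'a::lattice set \<Rightarrow> 'i set \<Rightarrow> ('i \<Rightarrow> 'a) \<Rightarrow> ('i \<Rightarrow> 'a) \<Rightarrow> bool" where
  "splitting_labelling L I j m \<longleftrightarrow> labelling L I j m \<and>
     (\<forall>i\<in>I. \<forall>z\<in>L. z \<le> sup (j i) (m i) \<or> inf (j i) (m i) \<le> z \<longrightarrow> z \<le> m i \<or> j i \<le> z)"

lemma splitting_labellingD:
  assumes "splitting_labelling L I j m"
  shows "labelling L I j m"
    "\<And>i z. i \<in> I \<Longrightarrow> z \<in> L \<Longrightarrow> z \<le> sup (j i) (m i) \<Longrightarrow> z \<le> m i \<or> j i \<le> z"
    "\<And>i z. i \<in> I \<Longrightarrow> z \<in> L \<Longrightarrow> inf (j i) (m i) \<le> z \<Longrightarrow> z \<le> m i \<or> j i \<le> z"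
  using assms unfolding splitting_labelling_def by blast+

lemma splitting_labelling_tight:
  assumes "splitting_labelling L I j m"
  shows "tight_labelling L I j m"
proof -
  note s = splitting_labellingD[OF assms]
  have "z \<le> m i" if "i \<in> I" "z \<in> L" "z < j i" for i z
    using s(2)[OF that(1,2)] that(3) by (meson le_supI1 less_imp_le leD)
  moreover have "j i \<le> z" if "i \<in> I" "z \<in> L" "m i < z" for i z
    using s(3)[OF that(1,2)] that(3) by (meson le_infI2 less_imp_le leD)
  ultimately show ?thesis unfolding tight_labelling_def using s(1) by blast
qed

text \<open>The value \<open>\<kappa> (j i)\<close> lies above \<open>inf (j i) (m i)\<close> but
  not above \<open>j i\<close>, so splitting puts it below \<open>m i\<close>. Since
  \<open>m i\<close> has the same meet with \<open>j i\<close>, maximality forces equality.\<close>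

lemma splitting_labelling_paired:
  assumes "splitting_labelling L I j m"
  shows "paired_by L I j m"
proof (rule paired_byI[OF splitting_labelling_tight[OF assms]])
  fix \<kappa> i assume "pairing L \<kappa>" and i: "i \<in> I"
  note s = splitting_labellingD[OF assms] and l = labellingD(1-4)[OF splitting_labellingD(1)[OF assms]]
  note t = tight_labelling_covers[OF splitting_labelling_tight[OF assms] i]
  have "\<kappa> (j i) \<in> max_partners L (j i)" using \<open>pairing L \<kappa>\<close> t(3) unfolding pairing_def by blast
  then have \<kappa>: "\<kappa> (j i) \<in> L" "inf (j i) (\<kappa> (j i)) = inf (j i) (m i)"
    "\<And>w. w \<in> L \<Longrightarrow> inf (j i) w = inf (j i) (m i) \<Longrightarrow> \<not> \<kappa> (j i) < w"
    unfolding max_partners_def maximal_elements_def t(4) by auto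
  have "\<not> j i \<le> \<kappa> (j i)" using \<kappa>(2) l(4)[OF i] by (metis inf.absorb1 inf.cobounded2)
  then have "\<kappa> (j i) \<le> m i" using s(3)[OF i \<kappa>(1)] \<kappa>(2) by (metis inf.cobounded2)
  then show "\<kappa> (j i) = m i" using \<kappa>(3)[OF l(3)[OF i]] by (auto simp: less_le)
qed

text \<open>As \<open>a \<le> m i\<close> and \<open>j i \<le> b\<close>, the join of the new pair
  is at most the old join and its meet is at least the old meet. So the old condition covers the new
  one.\<close>

lemma splitting_labelling_interval:
  assumes "splitting_labelling L I j m" "a \<in> L" "b \<in> L" "a \<le> b"
  shows "splitting_labelling (L \<inter> {a..b}) {i \<in> I. j i \<le> b \<and> a \<le> m i}
    (\<lambda>i. sup a (j i)) (\<lambda>i. inf b (m i))"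
proof -
  note s = splitting_labellingD[OF assms(1)]
  have "z \<le> inf b (m i) \<or> sup a (j i) \<le> z"
    if "i \<in> I" "j i \<le> b" "a \<le> m i" "z \<in> L" "a \<le> z" "z \<le> b"
      and "z \<le> sup (sup a (j i)) (inf b (m i)) \<or> inf (sup a (j i)) (inf b (m i)) \<le> z" for i z
  proof -
    have "sup (sup a (j i)) (inf b (m i)) \<le> sup (j i) (m i)"
      using that by (simp add: le_supI1 le_supI2 le_infI2)
    moreover have "inf (j i) (m i) \<le> inf (sup a (j i)) (inf b (m i))"
      using that by (simp add: le_infI1 le_infI2 le_supI2)
    ultimately have "z \<le> sup (j i) (m i) \<or> inf (j i) (m i) \<le> z"
      using that by (meson order.trans)
    then show ?thesis using s(2,3)[OF that(1,4)] that by auto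
  qed
  then show ?thesis
    unfolding splitting_labelling_def using labelling_interval[OF s(1) assms(2-4)] by auto
qed

text \<open>The index of any cover of the bottom works: there \<open>inf (j i) (m i)\<close> is the
  bottom, so the splitting condition reaches all of \<open>L\<close>.\<close>

lemma splitting_labelling_prime:
  assumes "splitting_labelling L I j m" "x \<in> L" "y \<in> L" "x < y"
  shows "\<exists>i\<in>I. \<forall>z\<in>L. z \<le> m i \<or> j i \<le> z"
proof -
  note s = splitting_labellingD[OF assms(1)] and l = labellingD[OF splitting_labellingD(1)[OF assms(1)]]
  obtain a where a: "a \<in> L" "\<And>z. z \<in> L \<Longrightarrow> a \<le> z" using ex_bottom[OF l(1)] by blast
  have "a < y" using a(2)[OF assms(2)] assms(4) by simp
  then obtain c where c: "covered_by L a c"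
    using ex_upper_cover[OF finite_sublatticeD(1)[OF l(1)] a(1) assms(3)] by blast
  then obtain i where i: "i \<in> I" "j i \<le> c" "a \<le> m i" using l(5) by blast
  have "inf (j i) (m i) \<le> inf c (m i)" using i(2) by (simp add: le_infI1)
  also have "\<dots> = a" using labelling_cover(2)[OF s(1) c i] .
  finally have "z \<le> m i \<or> j i \<le> z" if "z \<in> L" for z
    using s(3)[OF i(1) that] a(2)[OF that] by (meson order.trans)
  then show ?thesis using i(1) by blast
qed

lemma splitting_labelling_semidistrim:
  assumes "splitting_labelling L I j m"
  shows "semidistrim L"
proof (rule semidistrimI[OF _ splitting_labelling_paired[OF assms] splitting_labellingD(1)[OF assms]])
  note s = splitting_labellingD[OF assms]
  note l = labellingD[OF s(1)]
  show "compatibly_dismantlable L"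
    by (rule compatibly_dismantlable_of_class[of splitting_labelling, OF splitting_labellingD(1)
      splitting_labelling_paired splitting_labelling_interval splitting_labelling_prime assms])
  show "j i \<le> m k" if c: "covered_by L y x" "covered_by L y' x" "y \<noteq> y'"
    and i: "i \<in> I" "j i \<le> x" "y \<le> m i" and k: "k \<in> I" "j k \<le> x" "y' \<le> m k" for x y y' i k
  proof -
    \<comment> \<open>Splitting at \<open>i\<close> is applied to \<open>y'\<close>. If
      \<open>y' \<le> m i\<close>, then also \<open>x = sup y y'\<close> is below
      \<open>m i\<close>, contradicting \<open>j i \<le> x\<close>; hence
      \<open>j i \<le> y' \<le> m k\<close>.\<close>
    have "y' \<le> x" using c(2) covered_byD(4) by blast
    also have "x \<le> sup (j i) (m i)" using labelling_cover(1)[OF s(1) c(1) i] i(3)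
      by (metis sup.cobounded1 sup.mono sup.commute order.refl)
    finally have "y' \<le> m i \<or> j i \<le> y'" using s(2)[OF i(1)] c(2) covered_byD(1) by blast
    moreover have "\<not> y' \<le> m i"
      using sup_lower_covers[OF l(1) c] i l(4)[OF i(1)] by (metis le_supI order.trans)
    ultimately show ?thesis using k by auto
  qed
  show "j i \<le> m k" if c: "covered_by L x y" "covered_by L x y'" "y \<noteq> y'"
    and i: "i \<in> I" "j i \<le> y" "x \<le> m i" and k: "k \<in> I" "j k \<le> y'" "x \<le> m k" for x y y' i k
  proof -
    \<comment> \<open>Dually, splitting at \<open>k\<close> is applied to \<open>y\<close>:
      \<open>j k \<le> y\<close> would give \<open>j k \<le> inf y y' = x \<le> m k\<close>; hence
      \<open>j i \<le> y \<le> m k\<close>.\<close>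
    have "inf (j k) (m k) \<le> x" using labelling_cover(2)[OF s(1) c(2) k] k(2)
      by (metis inf.mono order.refl)
    also have "x \<le> y" using c(1) covered_byD(4) by blast
    finally have "y \<le> m k \<or> j k \<le> y" using s(3)[OF k(1)] c(1) covered_byD(2) by blast
    moreover have "\<not> j k \<le> y"
      using inf_upper_covers[OF l(1) c] k l(4)[OF k(1)] by (metis le_infI order.trans)
    ultimately show ?thesis using i by auto
  qed
qed

text \<open>Taking all splitting pairs as their own indices makes the splitting condition hold by
  construction. What remains is that each cover has exactly one such pair.\<close>

lemma splitting_labelling_of_semidistributive:
  assumes L: "finite_sublattice L" and "semidistributive L"
  defines "I \<equiv> {p \<in> L \<times> L. \<not> fst p \<le> snd p \<and>
    (\<forall>z\<in>L. z \<le> sup (fst p) (snd p) \<or> inf (fst p) (snd p) \<le> z \<longrightarrow> z \<le> snd p \<or> fst p \<le> z)}"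
  shows "splitting_labelling L I fst snd"
proof -
  note fs = finite_sublatticeD[OF L]
  have js: "sup x (inf y z) = sup x y" if "x \<in> L" "y \<in> L" "z \<in> L" "sup x y = sup x z" for x y z
    using assms(2) that unfolding semidistributive_def join_semidistributive_def by blast
  have ms: "inf x (sup y z) = inf x y" if "x \<in> L" "y \<in> L" "z \<in> L" "inf x y = inf x z" for x y z
    using assms(2) that unfolding semidistributive_def meet_semidistributive_def by blast
  have jcov: "sup x z = y \<longleftrightarrow> \<not> z \<le> x" if "covered_by L x y" "z \<in> L" "z \<le> y" for x y z
    using covered_by_sup_eq_iff[OF L that] .
  have mcov: "inf y z = x \<longleftrightarrow> \<not> y \<le> z" if "covered_by L x y" "z \<in> L" "x \<le> z" for x y z
    using covered_by_inf_eq_iff[OF L that] .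
  \<comment> \<open>In any splitting pair on the cover, \<open>j\<close> is least with
    \<open>sup x j = y\<close>. Otherwise \<open>inf j z\<close> still joins with \<open>x\<close>
    to \<open>y\<close> by join-semidistributivity, but splitting puts it below \<open>m\<close>, so
    \<open>y \<le> m\<close>.\<close>
  have jmin: "j \<le> z" if c: "covered_by L x y" and p: "(j, m) \<in> I" "j \<le> y" "x \<le> m"
    and z: "z \<in> L" "sup x z = y" for x y j m z
  proof (rule ccontr)
    assume n: "\<not> j \<le> z"
    have I: "j \<in> L" "m \<in> L" "\<not> j \<le> m"
      "\<And>z. z \<in> L \<Longrightarrow> z \<le> sup j m \<Longrightarrow> z \<le> m \<or> j \<le> z"
      using p unfolding I_def by auto
    have "inf j z \<le> sup j m" by (simp add: le_infI1 le_supI1)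
    then have "inf j z \<le> m" using I(4)[of "inf j z"] fs(3) I z n by auto
    moreover have "sup x j = y" using jcov[OF c I(1) p(2)] p(3) I(3) by (meson order.trans)
    then have "sup x (inf j z) = y" using js[of x j z] I z covered_byD[OF c] by simp
    ultimately have "y \<le> m" using p by auto
    then show False using I p by (meson order.trans)
  qed
  have mmax: "z \<le> m" if c: "covered_by L x y" and p: "(j, m) \<in> I" "j \<le> y" "x \<le> m"
    and z: "z \<in> L" "inf y z = x" for x y j m z
  proof (rule ccontr)
    assume n: "\<not> z \<le> m"
    have I: "j \<in> L" "m \<in> L" "\<not> j \<le> m"
      "\<And>z. z \<in> L \<Longrightarrow> inf j m \<le> z \<Longrightarrow> z \<le> m \<or> j \<le> z"
      using p unfolding I_def by auto
    have "inf j m \<le> sup m z" by (simp add: le_infI2 le_supI1)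
    then have "j \<le> sup m z" using I(4)[of "sup m z"] fs(4) I z n by auto
    moreover have "inf y m = x" using mcov[OF c I(2) p(3)] p(2) I(3) by (meson order.trans)
    then have "inf y (sup m z) = x" using ms[of y m z] I z covered_byD[OF c] by simp
    ultimately have "j \<le> x" using p by auto
    then show False using I p by (meson order.trans)
  qed
  have ex: "\<exists>p\<in>I. fst p \<le> y \<and> x \<le> snd p" if c: "covered_by L x y" for x y
  proof -
    note c' = covered_byD[OF c]
    let ?J = "{z \<in> L. z \<le> y \<and> \<not> z \<le> x}" and ?M = "{z \<in> L. x \<le> z \<and> \<not> y \<le> z}"
    have "finite ?J" "y \<in> ?J" "finite ?M" "x \<in> ?M" using fs(1) c' by auto
    \<comment> \<open>Arbitrary minimal and maximal choices suffice here; \<open>jmin\<close> and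
      \<open>mmax\<close> show later that they are forced.\<close>
    then obtain j m where j: "j \<in> ?J" "\<And>w. w \<in> ?J \<Longrightarrow> \<not> w < j"
      and m: "m \<in> ?M" "\<And>w. w \<in> ?M \<Longrightarrow> \<not> m < w"
      by (metis (no_types, lifting) finite_minimalE finite_maximalE)
    have jx: "sup x j = y" and mx: "inf y m = x" using jcov[OF c] mcov[OF c] j(1) m(1) by auto
    have jm: "\<not> j \<le> m" using j(1) mx by auto
    have jlow: "w \<le> x" if "w \<in> L" "w < j" for w
      using j(2)[of w] j(1) that by (auto dest: less_imp_le order.trans)
    have mupp: "y \<le> w" if "w \<in> L" "m < w" for w
      using m(2)[of w] m(1) that by (auto dest: less_imp_le order.trans)
    \<comment> \<open>If both fail, \<open>m\<close> has equal joins with \<open>j\<close> and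
      \<open>z\<close>, hence the same join with \<open>inf j z\<close>. But \<open>inf j z\<close>
      is strictly below \<open>j\<close>, so it lies below \<open>x\<close> and thus below
      \<open>m\<close>. Case \<open>2\<close> is dual.\<close>
    have 1: "z \<le> m \<or> j \<le> z" if z: "z \<in> L" "z \<le> sup j m" for z
    proof (rule ccontr)
      assume n: "\<not> (z \<le> m \<or> j \<le> z)"
      then have "m < sup m z" using less_sup_left by blast
      then have "y \<le> sup m z" using mupp fs(4) m(1) z by simp
      then have "sup m j = sup m z" using z j(1) by (intro order.antisym) (auto simp: sup.commute)
      then have e: "sup m (inf j z) = sup m j" using js m(1) j(1) z by simp
      have "inf j z \<le> x" using jlow fs(3) j(1) z n inf_less_left by (metis (no_types, lifting) mem_Collect_eq)
      then have "inf j z \<le> m" using m(1) by auto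
      then show False using e jm by (metis sup.absorb1 sup.cobounded2)
    qed
    have 2: "z \<le> m \<or> j \<le> z" if z: "z \<in> L" "inf j m \<le> z" for z
    proof (rule ccontr)
      assume n: "\<not> (z \<le> m \<or> j \<le> z)"
      then have "inf j z < j" using inf_less_left by blast
      then have "inf j z \<le> x" using jlow fs(3) j(1) z by simp
      then have "inf j m = inf j z" using z m(1) by (intro order.antisym) (auto intro: order.trans)
      then have e: "inf j (sup m z) = inf j m" using ms m(1) j(1) z by simp
      have "y \<le> sup m z" using mupp fs(4) m(1) z n less_sup_left by (metis (no_types, lifting) mem_Collect_eq)
      then have "j \<le> sup m z" using j(1) by auto
      then show False using e jm by (metis inf.absorb1 inf.cobounded2)
    qed
    have "(j, m) \<in> I" unfolding I_def using 1 2 j(1) m(1) jm by auto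
    then show ?thesis using j(1) m(1) by force
  qed
  have "\<exists>!p. p \<in> I \<and> fst p \<le> y \<and> x \<le> snd p" if c: "covered_by L x y" for x y
  proof -
    have "p = q" if p: "p \<in> I" "fst p \<le> y" "x \<le> snd p" and q: "q \<in> I" "fst q \<le> y" "x \<le> snd q" for p q
    proof -
      have L: "fst p \<in> L" "snd p \<in> L" "\<not> fst p \<le> snd p" "fst q \<in> L" "snd q \<in> L" "\<not> fst q \<le> snd q"
        using p q unfolding I_def by auto
      then have s: "sup x (fst p) = y" "sup x (fst q) = y" "inf y (snd p) = x" "inf y (snd q) = x"
        using jcov[OF c] mcov[OF c] p q by (meson order.trans)+
      have "fst p \<le> fst q" "fst q \<le> fst p"
        using jmin[OF c, of "fst p" "snd p" "fst q"] jmin[OF c, of "fst q" "snd q" "fst p"] p q s L by auto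
      moreover have "snd p \<le> snd q" "snd q \<le> snd p"
        using mmax[OF c, of "fst p" "snd p" "snd q"] mmax[OF c, of "fst q" "snd q" "snd p"] p q s L by auto
      ultimately show ?thesis by (simp add: prod_eq_iff)
    qed
    then show ?thesis using ex[OF c] by metis
  qed
  then have "labelling L I fst snd" unfolding labelling_def using L by (auto simp: I_def)
  then show ?thesis unfolding splitting_labelling_def by (auto simp: I_def)
qed

section \<open>Triangular labellings\<close>

text \<open>Once \<open>j i\<close> is paired with \<open>m i\<close>, triangularity says that edges
  of the Galois graph lead only from larger to smaller indices.\<close>

definition triangular_labelling ::
    "'a::lattice set \<Rightarrow> nat set \<Rightarrow> (nat \<Rightarrow> 'a) \<Rightarrow> (nat \<Rightarrow> 'a) \<Rightarrow> bool" where
  "triangular_labelling L I j m \<longleftrightarrow> labelling L I j m \<and> (\<forall>i\<in>I. \<forall>k\<in>I. i < k \<longrightarrow> j i \<le> m k)"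

lemma triangular_labellingD:
  assumes "triangular_labelling L I j m"
  shows "labelling L I j m" "\<And>i k. i \<in> I \<Longrightarrow> k \<in> I \<Longrightarrow> i < k \<Longrightarrow> j i \<le> m k"
  using assms unfolding triangular_labelling_def by blast+

text \<open>\<open>p\<close> is the index of a cover going up from \<open>inf z (m i)\<close> inside
  \<open>z\<close>. If \<open>p < i\<close>, then \<open>j p\<close> would lie below
  \<open>m i\<close> and \<open>z\<close>, hence below \<open>m p\<close>.\<close>

lemma triangular_labelling_above_inf:
  assumes t: "triangular_labelling L I j m" and i: "i \<in> I" and z: "z \<in> L" "\<not> z \<le> m i"
  shows "\<exists>p\<in>I. i \<le> p \<and> j p \<le> z \<and> inf z (m i) \<le> m p"
proof -
  note d = triangular_labellingD[OF t]
  note l = labellingD[OF d(1)]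
  note fs = finite_sublatticeD[OF l(1)]
  obtain w where w: "covered_by L (inf z (m i)) w" "w \<le> z"
    using ex_upper_cover[OF fs(1) fs(3)[OF z(1) l(3)[OF i]] z(1) inf_less_left[OF z(2)]] by blast
  obtain p where p: "p \<in> I" "j p \<le> w" "inf z (m i) \<le> m p" using l(5)[OF w(1)] by blast
  have "\<not> p < i"
  proof
    assume "p < i"
    then have "j p \<le> inf z (m i)" using d(2)[OF p(1) i] p(2) w(2) by auto
    then show False using l(4)[OF p(1)] p(3) by (meson order.trans)
  qed
  then show ?thesis using p w(2) by (meson not_less order.trans)
qed

lemma triangular_labelling_below_sup:
  assumes t: "triangular_labelling L I j m" and i: "i \<in> I" and z: "z \<in> L" "\<not> j i \<le> z"
  shows "\<exists>p\<in>I. p \<le> i \<and> z \<le> m p \<and> j p \<le> sup z (j i)"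
proof -
  note d = triangular_labellingD[OF t]
  note l = labellingD[OF d(1)]
  note fs = finite_sublatticeD[OF l(1)]
  obtain w where w: "covered_by L w (sup z (j i))" "z \<le> w"
    using ex_lower_cover[OF fs(1) z(1) fs(4)[OF z(1) l(2)[OF i]] less_sup_left[OF z(2)]] by blast
  obtain p where p: "p \<in> I" "j p \<le> sup z (j i)" "w \<le> m p" using l(5)[OF w(1)] by blast
  have "\<not> i < p"
  proof
    assume "i < p"
    then have "sup z (j i) \<le> m p" using d(2)[OF i p(1)] p(3) w(2) by auto
    then show False using l(4)[OF p(1)] p(2) by (meson order.trans)
  qed
  then show ?thesis using p w(2) by (meson not_less order.trans)
qed

text \<open>A violation yields an index \<open>p \<noteq> i\<close> on the side of \<open>i\<close>
  where triangularity applies, and the chain of inequalities through \<open>z\<close> ends in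
  \<open>j p \<le> m p\<close>.\<close>

lemma triangular_labelling_tight:
  assumes "triangular_labelling L I j m"
  shows "tight_labelling L I j m"
proof -
  note d = triangular_labellingD[OF assms]
  note l = labellingD[OF d(1)]
  have "z \<le> m i" if i: "i \<in> I" and z: "z \<in> L" "z < j i" for i z
  proof (rule ccontr)
    assume "\<not> z \<le> m i"
    then obtain p where p: "p \<in> I" "i \<le> p" "j p \<le> z"
      using triangular_labelling_above_inf[OF assms i z(1)] by blast
    then have "p \<noteq> i" using z(2) by auto
    then have "j i \<le> m p" using d(2)[OF i p(1)] p(2) by simp
    then have "j p \<le> m p" using p(3) z(2) by (meson less_imp_le order.trans)
    then show False using l(4)[OF p(1)] by blast
  qed
  moreover have "j i \<le> z" if i: "i \<in> I" and z: "z \<in> L" "m i < z" for i z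
  proof (rule ccontr)
    assume "\<not> j i \<le> z"
    then obtain p where p: "p \<in> I" "p \<le> i" "z \<le> m p"
      using triangular_labelling_below_sup[OF assms i z(1)] by blast
    then have "p \<noteq> i" using z(2) by auto
    then have "j p \<le> m i" using d(2)[OF p(1) i] p(2) by simp
    then have "j p \<le> m p" using p(3) z(2) by (meson less_imp_le order.trans)
    then show False using l(4)[OF p(1)] by blast
  qed
  ultimately show ?thesis unfolding tight_labelling_def using d(1) by blast
qed

lemma triangular_labelling_finite:
  assumes "triangular_labelling L I j m"
  shows "finite I"
proof -
  note d = triangular_labellingD[OF assms]
  note b = tight_labelling_bij(1)[OF triangular_labelling_tight[OF assms]]
  have "finite (join_irreducibles L)"
    using finite_sublatticeD(1)[OF labellingD(1)[OF d(1)]] unfolding join_irreducibles_def by simp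
  then show ?thesis using bij_betw_finite[OF b] by blast
qed

lemma triangular_labelling_paired:
  assumes "triangular_labelling L I j m"
  shows "paired_by L I j m"
proof (rule paired_byI[OF triangular_labelling_tight[OF assms]])
  fix \<kappa> i assume \<kappa>: "pairing L \<kappa>" and "i \<in> I"
  note d = triangular_labellingD[OF assms]
  note l = labellingD[OF d(1)]
  note t = tight_labelling_covers[OF triangular_labelling_tight[OF assms]]
  note b = tight_labelling_bij[OF triangular_labelling_tight[OF assms]]
  have \<kappa>bij: "bij_betw \<kappa> (join_irreducibles L) (meet_irreducibles L)"
    using \<kappa> unfolding pairing_def by blast
  \<comment> \<open>Since \<open>\<kappa> (j i)\<close> is not above \<open>j i\<close>,
    triangularity makes it some \<open>m k\<close> with \<open>k \<le> i\<close>. By induction each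
    \<open>m k\<close> with \<open>k < i\<close> is already the value at \<open>j k\<close>.\<close>
  show "\<kappa> (j i) = m i" using \<open>i \<in> I\<close>
  proof (induction i rule: less_induct)
    case (less i)
    have "\<kappa> (j i) \<in> m ` I"
      using \<kappa>bij t(3)[OF less.prems] b(2) unfolding bij_betw_def by blast
    then obtain k where k: "k \<in> I" "\<kappa> (j i) = m k" by blast
    have "\<kappa> (j i) \<in> max_partners L (j i)"
      using \<kappa> t(3)[OF less.prems] unfolding pairing_def by blast
    then have "inf (j i) (m k) = inf (j i) (m i)"
      unfolding max_partners_def maximal_elements_def t(4)[OF less.prems] k(2) by simp
    then have "\<not> j i \<le> m k" using l(4)[OF less.prems] by (metis inf.absorb1 inf.cobounded2)
    then have "k \<le> i" using d(2)[OF less.prems k(1)] by (meson not_less)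
    moreover have "\<not> k < i"
    proof
      assume "k < i"
      then have "\<kappa> (j k) = \<kappa> (j i)" using less.IH k by simp
      then have "j k = j i"
        using \<kappa>bij t(3)[OF less.prems] t(3)[OF k(1)] unfolding bij_betw_def inj_on_def by blast
      then have "k = i" using b(1) k(1) less.prems unfolding bij_betw_def inj_on_def by blast
      then show False using \<open>k < i\<close> by simp
    qed
    ultimately show ?case using k(2) by simp
  qed
qed

lemma triangular_labelling_interval:
  assumes "triangular_labelling L I j m" "a \<in> L" "b \<in> L" "a \<le> b"
  shows "triangular_labelling (L \<inter> {a..b}) {i \<in> I. j i \<le> b \<and> a \<le> m i}
    (\<lambda>i. sup a (j i)) (\<lambda>i. inf b (m i))"
proof -
  note d = triangular_labellingD[OF assms(1)]
  show ?thesis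
    unfolding triangular_labelling_def
    using labelling_interval[OF d(1) assms(2-4)] d(2) assms(4) by auto
qed

text \<open>The largest index of an interval divides it as a prime pair: the index
  \<open>p \<ge> i\<close> given by \<open>triangular_labelling_above_inf\<close> still belongs to
  the interval, so it is \<open>i\<close>.\<close>

lemma triangular_labelling_max:
  assumes t: "triangular_labelling L I j m" and i: "i \<in> I"
    and max: "\<And>p. p \<in> I \<Longrightarrow> j p \<le> b \<Longrightarrow> a \<le> m p \<Longrightarrow> p \<le> i"
    and "a \<le> m i" and z: "z \<in> L" "a \<le> z" "z \<le> b"
  shows "z \<le> m i \<or> j i \<le> z"
proof (cases "z \<le> m i")
  case False
  then obtain p where p: "p \<in> I" "i \<le> p" "j p \<le> z" "inf z (m i) \<le> m p"
    using triangular_labelling_above_inf[OF t i z(1)] by blast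
  have "a \<le> inf z (m i)" using z assms(4) by simp
  then have "p \<le> i" using max[OF p(1)] p z(3) by (meson order.trans)
  then show ?thesis using p by simp
qed simp

lemma triangular_labelling_min:
  assumes t: "triangular_labelling L I j m" and i: "i \<in> I"
    and min: "\<And>p. p \<in> I \<Longrightarrow> j p \<le> b \<Longrightarrow> a \<le> m p \<Longrightarrow> i \<le> p"
    and "j i \<le> b" and z: "z \<in> L" "a \<le> z" "z \<le> b"
  shows "z \<le> m i \<or> j i \<le> z"
proof (cases "j i \<le> z")
  case False
  then obtain p where p: "p \<in> I" "p \<le> i" "z \<le> m p" "j p \<le> sup z (j i)"
    using triangular_labelling_below_sup[OF t i z(1)] by blast
  have "sup z (j i) \<le> b" using z assms(4) by simp
  then have "i \<le> p" using min[OF p(1)] p z(2) by (meson order.trans)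
  then show ?thesis using p by simp
qed simp

lemma triangular_labelling_prime:
  assumes t: "triangular_labelling L I j m" and xy: "x \<in> L" "y \<in> L" "x < y"
  shows "\<exists>i\<in>I. \<forall>z\<in>L. z \<le> m i \<or> j i \<le> z"
proof -
  note l = labellingD[OF triangular_labellingD(1)[OF t]]
  obtain a where a: "a \<in> L" "\<And>z. z \<in> L \<Longrightarrow> a \<le> z" using ex_bottom[OF l(1)] by blast
  obtain b where b: "b \<in> L" "\<And>z. z \<in> L \<Longrightarrow> z \<le> b" using ex_top[OF l(1)] by blast
  obtain w where "covered_by L x w"
    using ex_upper_cover[OF finite_sublatticeD(1)[OF l(1)] xy] by blast
  then have "\<exists>i. i \<in> I" using l(5) by blast
  define i where "i = (LEAST i. i \<in> I)"
  have i: "i \<in> I" unfolding i_def using \<open>\<exists>i. i \<in> I\<close> by (rule LeastI_ex)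
  have "i \<le> p" if "p \<in> I" for p unfolding i_def using that by (rule Least_le)
  then have "z \<le> m i \<or> j i \<le> z" if "z \<in> L" for z
    using triangular_labelling_min[OF t i, of b a z] l(2)[OF i] a b that by blast
  then show ?thesis using i by blast
qed

text \<open>In the interval from \<open>y \<sqinter> y'\<close> to \<open>x\<close> the index \<open>k\<close> is the largest one. The cover just above
  \<open>y \<sqinter> y'\<close> on the way to \<open>y\<close> cannot have a smaller index, so its index is \<open>k\<close> and \<open>j k \<le> y\<close>.\<close>

lemma triangular_labelling_down:
  assumes t: "triangular_labelling L I j m"
    and c: "covered_by L y x" "covered_by L y' x" "y \<noteq> y'"
    and i: "i \<in> I" "j i \<le> x" "y \<le> m i" and k: "k \<in> I" "j k \<le> x" "y' \<le> m k" and "i < k"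
  shows "j k \<le> m i"
proof -
  note d = triangular_labellingD[OF t]
  note l = labellingD[OF d(1)]
  note fs = finite_sublatticeD[OF l(1)]
  note y = covered_byD[OF c(1)] and y' = covered_byD[OF c(2)]
  let ?a = "inf y y'"
  define S where "S = {p \<in> I. j p \<le> x \<and> ?a \<le> m p}"
  have "finite S" unfolding S_def using triangular_labelling_finite[OF t] by simp
  have "k \<in> S" unfolding S_def using k by (auto intro: le_infI2)
  define l' where "l' = Max S"
  have l': "l' \<in> S" "k \<le> l'" "\<And>p. p \<in> S \<Longrightarrow> p \<le> l'"
    unfolding l'_def using \<open>finite S\<close> \<open>k \<in> S\<close> by (auto intro: Max_in)
  then have l'S: "l' \<in> I" "j l' \<le> x" "?a \<le> m l'" unfolding S_def by auto
  have mx: "z \<le> m l' \<or> j l' \<le> z" if "z \<in> L" "?a \<le> z" "z \<le> x" for z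
    by (rule triangular_labelling_max[OF t l'S(1) _ l'S(3) that]) (use l'(3) S_def in blast)
  \<comment> \<open>The largest index \<open>l'\<close> divides the interval, and
    \<open>j l'\<close> is not below \<open>?a\<close>, so \<open>y\<close> or \<open>y'\<close> is
    below \<open>m l'\<close>. Thus \<open>l'\<close> labels one of the two given covers, and
    \<open>i < k \<le> l'\<close> leaves \<open>k\<close>.\<close>
  have "\<not> (j l' \<le> y \<and> j l' \<le> y')" using l'S(3) l(4)[OF l'S(1)] by (meson le_infI order.trans)
  then have "y \<le> m l' \<or> y' \<le> m l'"
    using mx[of y] mx[of y'] y y' by auto
  then have "l' = i \<or> l' = k" using l(6)[OF c(1) i l'S(1,2)] l(6)[OF c(2) k l'S(1,2)] by auto
  then have lk: "l' = k" using l'(2) \<open>i < k\<close> by auto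
  have "\<not> y \<le> y'" using y(5)[of y'] y' c(3) by auto
  then have "?a < y" by (rule inf_less_left)
  then obtain w where w: "covered_by L ?a w" "w \<le> y"
    using ex_upper_cover[OF fs(1) fs(3)[OF y(1) y'(1)] y(1)] by blast
  obtain p where p: "p \<in> I" "j p \<le> w" "?a \<le> m p" using l(5)[OF w(1)] by blast
  have py: "j p \<le> y" using p w by (meson order.trans)
  then have "p \<in> S" unfolding S_def using p y(4) by (auto intro: order.trans)
  then have "p \<le> k" using l'(3) lk by blast
  \<comment> \<open>Both \<open>y'\<close> and \<open>j p\<close> would be below \<open>m k\<close>,
    and their join is \<open>x\<close>.\<close>
  moreover have "\<not> p < k"
  proof
    assume "p < k"
    then have pk: "j p \<le> m k" using d(2)[OF p(1) k(1)] by blast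
    have "\<not> j p \<le> y'" using py p(3) l(4)[OF p(1)] by (meson le_infI order.trans)
    then have "sup y' (j p) = x"
      using covered_by_sup_eq_iff[OF l(1) c(2) l(2)[OF p(1)]] py y(4) by (meson order.trans)
    then have "x \<le> m k" using pk k(3) by auto
    then show False using labelling_cover(4)[OF d(1) c(2) k] by blast
  qed
  ultimately have "p = k" by simp
  then show ?thesis using py i(3) by (meson order.trans)
qed

text \<open>In the interval from \<open>x\<close> to \<open>sup y y'\<close> the index
  \<open>i\<close> is the smallest one. A cover just below the join, on the way from
  \<open>y'\<close>, must have index \<open>i\<close>, so
  \<open>j k \<le> y' \<le> m i\<close>.\<close>

lemma triangular_labelling_up:
  assumes t: "triangular_labelling L I j m"
    and c: "covered_by L x y" "covered_by L x y'" "y \<noteq> y'"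
    and i: "i \<in> I" "j i \<le> y" "x \<le> m i" and k: "k \<in> I" "j k \<le> y'" "x \<le> m k" and "i < k"
  shows "j k \<le> m i"
proof -
  note d = triangular_labellingD[OF t]
  note l = labellingD[OF d(1)]
  note fs = finite_sublatticeD[OF l(1)]
  note y = covered_byD[OF c(1)] and y' = covered_byD[OF c(2)]
  let ?b = "sup y y'"
  define S where "S = {p \<in> I. j p \<le> ?b \<and> x \<le> m p}"
  have "finite S" unfolding S_def using triangular_labelling_finite[OF t] by simp
  have "i \<in> S" unfolding S_def using i by (auto intro: le_supI1)
  define l' where "l' = Min S"
  have l': "l' \<in> S" "l' \<le> i" "\<And>p. p \<in> S \<Longrightarrow> l' \<le> p"
    unfolding l'_def using \<open>finite S\<close> \<open>i \<in> S\<close> by (auto intro: Min_in)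
  then have l'S: "l' \<in> I" "j l' \<le> ?b" "x \<le> m l'" unfolding S_def by auto
  have mn: "z \<le> m l' \<or> j l' \<le> z" if "z \<in> L" "x \<le> z" "z \<le> ?b" for z
    by (rule triangular_labelling_min[OF t l'S(1) _ l'S(2) that]) (use l'(3) S_def in blast)
  have "\<not> (y \<le> m l' \<and> y' \<le> m l')" using l'S(2) l(4)[OF l'S(1)] by (meson le_supI order.trans)
  then have "j l' \<le> y \<or> j l' \<le> y'"
    using mn[of y] mn[of y'] y y' by auto
  then have "l' = i \<or> l' = k" using l(6)[OF c(1) i l'S(1) _ l'S(3)] l(6)[OF c(2) k l'S(1) _ l'S(3)] by auto
  then have li: "l' = i" using l'(2) \<open>i < k\<close> by auto
  have "\<not> y \<le> y'" using y'(5)[of y] y c(3) by auto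
  then have "y' < ?b" using less_sup_left[of y y'] by (simp add: sup.commute)
  then obtain w where w: "covered_by L w ?b" "y' \<le> w"
    using ex_lower_cover[OF fs(1) y'(2) fs(4)[OF y(2) y'(2)]] by blast
  obtain p where p: "p \<in> I" "j p \<le> ?b" "w \<le> m p" using l(5)[OF w(1)] by blast
  have py: "y' \<le> m p" using p w by (meson order.trans)
  then have xp: "x \<le> m p" using y'(4) by (meson order.trans)
  then have "p \<in> S" unfolding S_def using p by auto
  then have "i \<le> p" using l'(3) li by blast
  moreover have "\<not> i < p"
  proof
    assume "i < p"
    then have ip: "j i \<le> m p" using d(2)[OF i(1) p(1)] by blast
    have "\<not> y \<le> m p" using py p(2) l(4)[OF p(1)] by (meson le_supI order.trans)
    then have "inf y (m p) = x"
      using covered_by_inf_eq_iff[OF l(1) c(1) l(3)[OF p(1)] xp] by blast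
    then have "j i \<le> x" using ip i(2) by auto
    then show False using labelling_cover(3)[OF d(1) c(1) i] by blast
  qed
  ultimately have "p = i" by simp
  then show ?thesis using py k(2) by (meson order.trans)
qed

lemma triangular_labelling_semidistrim:
  assumes "triangular_labelling L I j m"
  shows "semidistrim L"
proof (rule semidistrimI[OF _ triangular_labelling_paired[OF assms] triangular_labellingD(1)[OF assms]])
  note d = triangular_labellingD[OF assms]
  note l = labellingD[OF d(1)]
  show "compatibly_dismantlable L"
    by (rule compatibly_dismantlable_of_class[of triangular_labelling, OF triangular_labellingD(1)
      triangular_labelling_paired triangular_labelling_interval triangular_labelling_prime assms])
  show "j i \<le> m k" if c: "covered_by L y x" "covered_by L y' x" "y \<noteq> y'"
    and i: "i \<in> I" "j i \<le> x" "y \<le> m i" and k: "k \<in> I" "j k \<le> x" "y' \<le> m k" for x y y' i k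
  proof -
    \<comment> \<open>A common index would put \<open>x = sup y y'\<close> below \<open>m i\<close>.
      For \<open>i < k\<close> triangularity itself suffices; \<open>k < i\<close> needs the
      preceding lemmas with the covers exchanged.\<close>
    have "i \<noteq> k" using sup_lower_covers[OF l(1) c] i(3) k(3) labelling_cover(4)[OF d(1) c(1) i] by auto
    then consider "i < k" | "k < i" by linarith
    then show ?thesis
      using d(2)[OF i(1) k(1)] triangular_labelling_down[OF assms c(2,1) c(3)[symmetric] k i] by cases
  qed
  show "j i \<le> m k" if c: "covered_by L x y" "covered_by L x y'" "y \<noteq> y'"
    and i: "i \<in> I" "j i \<le> y" "x \<le> m i" and k: "k \<in> I" "j k \<le> y'" "x \<le> m k" for x y y' i k
  proof -
    have "i \<noteq> k" using inf_upper_covers[OF l(1) c] i(2) k(2) labelling_cover(3)[OF d(1) c(1) i] by auto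
    then consider "i < k" | "k < i" by linarith
    then show ?thesis
      using d(2)[OF i(1) k(1)] triangular_labelling_up[OF assms c(2,1) c(3)[symmetric] k i] by cases
  qed
qed

section \<open>Trim lattices\<close>

text \<open>Only \<open>C\<close> is totally ordered, not the type, so the list is built by
  splitting off the greatest element.\<close>

lemma finite_chain_sorted_list:
  fixes C :: "'a::order set"
  assumes "finite C" "\<And>x y. x \<in> C \<Longrightarrow> y \<in> C \<Longrightarrow> x \<le> y \<or> y \<le> x"
  shows "\<exists>xs. set xs = C \<and> sorted_wrt (<) xs"
  using assms
proof (induction "card C" arbitrary: C)
  case 0
  then show ?case by (intro exI[of _ "[]"]) simp
next
  case (Suc n)
  then obtain x where x: "x \<in> C" by fastforce
  obtain b where b: "b \<in> C" "\<And>w. w \<in> C \<Longrightarrow> \<not> b < w"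
    using finite_maximalE[OF Suc.prems(1) x] by blast
  have "\<exists>xs. set xs = C - {b} \<and> sorted_wrt (<) xs"
    by (rule Suc.hyps(1)) (use Suc b(1) in auto)
  then obtain xs where xs: "set xs = C - {b}" "sorted_wrt (<) xs" by blast
  have "w < b" if "w \<in> C - {b}" for w
    using Suc.prems(2)[of w b] b that by (auto simp: less_le)
  then have "set (xs @ [b]) = C \<and> sorted_wrt (<) (xs @ [b])"
    using xs b(1) by (auto simp: sorted_wrt_append)
  then show ?case by blast
qed

lemma maxchain_covers:
  assumes L: "finite_sublattice L" and C: "pred_on.maxchain L (<) C"
  obtains c :: "nat \<Rightarrow> 'a::lattice" and r where
    "\<And>z. z \<in> L \<Longrightarrow> c 0 \<le> z" "\<And>z. z \<in> L \<Longrightarrow> z \<le> c r"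
    "\<And>i. i < r \<Longrightarrow> covered_by L (c i) (c (Suc i))" "\<And>i. i \<le> r \<Longrightarrow> c i \<in> C"
proof -
  have CL: "C \<subseteq> L" and tot: "\<And>x y. x \<in> C \<Longrightarrow> y \<in> C \<Longrightarrow> x \<le> y \<or> y \<le> x"
    using C unfolding pred_on.maxchain_def pred_on.chain_def by (auto simp: less_le)
  \<comment> \<open>Maximality of the chain: an element comparable with all of \<open>C\<close>
    could be added. This puts the bottom and the top into \<open>C\<close> and excludes elements
    between neighbours.\<close>
  have max: "z \<in> C" if z: "z \<in> L" and cmp: "\<And>x. x \<in> C \<Longrightarrow> x \<le> z \<or> z \<le> x" for z
  proof (rule ccontr)
    assume "z \<notin> C"
    moreover have "pred_on.chain L (<) (insert z C)"
      unfolding pred_on.chain_def using CL z tot cmp by (auto simp: less_le)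
    ultimately show False using C unfolding pred_on.maxchain_def by blast
  qed
  have "finite C" using CL finite_sublatticeD(1)[OF L] finite_subset by blast
  then obtain xs where xs: "set xs = C" "sorted_wrt (<) xs"
    using finite_chain_sorted_list[OF _ tot] by blast
  obtain a where a: "a \<in> L" "\<And>z. z \<in> L \<Longrightarrow> a \<le> z" using ex_bottom[OF L] by blast
  obtain b where b: "b \<in> L" "\<And>z. z \<in> L \<Longrightarrow> z \<le> b" using ex_top[OF L] by blast
  have "a \<in> C" "b \<in> C" using max a b CL by blast+
  then obtain r where r: "length xs = Suc r" using xs(1) by (cases xs) auto
  have less: "xs ! i < xs ! k" if "i < k" "k \<le> r" for i k
    using sorted_wrt_nth_less[OF xs(2)] that r by simp
  have le: "xs ! i \<le> xs ! k" if "i \<le> k" "k \<le> r" for i k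
    using less[of i k] that by (cases "i = k") auto
  have mem: "xs ! i \<in> C" if "i \<le> r" for i using that r xs(1) by auto
  have idx: "\<exists>i\<le>r. z = xs ! i" if "z \<in> C" for z
    using that r xs(1) by (metis in_set_conv_nth less_Suc_eq_le)
  show ?thesis
  proof (rule that[of "\<lambda>i. xs ! i" r])
    obtain i where "i \<le> r" "a = xs ! i" using idx[OF \<open>a \<in> C\<close>] by blast
    then have "xs ! 0 \<le> a" using le[of 0 i] by simp
    then show "xs ! 0 \<le> z" if "z \<in> L" for z using a(2)[OF that] by simp
    obtain i where "i \<le> r" "b = xs ! i" using idx[OF \<open>b \<in> C\<close>] by blast
    then have "b \<le> xs ! r" using le[of i r] by simp
    then show "z \<le> xs ! r" if "z \<in> L" for z using b(2)[OF that] by simp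
    show "xs ! i \<in> C" if "i \<le> r" for i using mem[OF that] .
    show "covered_by L (xs ! i) (xs ! Suc i)" if i: "i < r" for i
      unfolding covered_by_def
    proof (intro conjI notI)
      show "xs ! i \<in> L" "xs ! Suc i \<in> L" "xs ! i < xs ! Suc i"
        using mem[of i] mem[of "Suc i"] less[of i "Suc i"] CL i by auto
      assume "\<exists>z\<in>L. xs ! i < z \<and> z < xs ! Suc i"
      then obtain z where z: "z \<in> L" "xs ! i < z" "z < xs ! Suc i" by blast
      have "x \<le> z \<or> z \<le> x" if x: "x \<in> C" for x
      proof -
        obtain k where k: "k \<le> r" "x = xs ! k" using idx[OF x] by blast
        show ?thesis
        proof (cases "k \<le> i")
          case True
          then have "x \<le> xs ! i" using le[of k i] k i by simp
          then show ?thesis using z(2) by auto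
        next
          case False
          then have "xs ! Suc i \<le> x" using le[of "Suc i" k] k by simp
          then show ?thesis using z(3) by auto
        qed
      qed
      then have "z \<in> C" using max[OF z(1)] by blast
      then obtain k where k: "k \<le> r" "z = xs ! k" using idx by blast
      show False
      proof (cases "k \<le> i")
        case True
        then show ?thesis using le[of k i] k i z(2) by auto
      next
        case False
        then show ?thesis using le[of "Suc i" k] k z(3) by auto
      qed
    qed
  qed
qed

lemma left_modular_elementD:
  assumes "left_modular_element L x" "y \<in> L" "z \<in> L" "y \<le> z"
  shows "inf (sup y x) z = sup y (inf x z)"
  using assms unfolding left_modular_element_def by blast

text \<open>Distinct covers of a chain get distinct indices in a left modular chain, so the latter is a
  longest chain.\<close>

lemma left_modular_cover_index_distinct:
  assumes L: "finite_sublattice L" and c: "covered_by L c c'" and lm: "left_modular_element L c"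
    and yz: "y \<in> L" "z \<in> L" "y' \<in> L" "z' \<in> L" "z \<le> y'" "y' \<le> z'"
    and i: "\<not> inf c' z \<le> y" "inf c z \<le> y" "inf c z' \<le> y'"
  shows "inf c' z' \<le> y'"
proof -
  note fs = finite_sublatticeD[OF L] and c' = covered_byD[OF c]
  let ?u = "inf c' z"
  have u: "?u \<in> L" using fs(3) c'(2) yz(2) by blast
  have "\<not> ?u \<le> c" using i(1,2) by (meson inf.cobounded2 le_infI order.trans)
  \<comment> \<open>With \<open>c'\<close> written as the join of \<open>c\<close> and
    \<open>?u\<close>, left modularity turns \<open>inf c' z'\<close> into
    \<open>sup ?u (inf c z')\<close>, and both parts are below \<open>y'\<close>.\<close>
  then have "sup c ?u = c'" using covered_by_sup_eq_iff[OF L c u] by simp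
  then have "inf c' z' = inf (sup ?u c) z'" by (simp add: sup.commute)
  also have "?u \<le> z'" using yz(5,6) by (meson inf.cobounded2 order.trans)
  then have "inf (sup ?u c) z' = sup ?u (inf c z')"
    using left_modular_elementD[OF lm u yz(4)] by blast
  also have "\<dots> \<le> y'" using i(3) yz(5) by (auto intro: le_infI2)
  finally show ?thesis .
qed

lemma triangular_labelling_of_trim:
  assumes L: "finite_sublattice L" and "trim L"
  shows "\<exists>I j m. triangular_labelling L I j m"
proof -
  note fs = finite_sublatticeD[OF L]
  obtain xs n where xs: "set xs \<subseteq> L" "length xs = n + 1" "successively (covered_by L) xs"
    and cards: "card (join_irreducibles L) = n" "card (meet_irreducibles L) = n"
    using assms(2) unfolding trim_def extremal_def by blast
  obtain C where C: "pred_on.maxchain L (<) C" "\<And>x. x \<in> C \<Longrightarrow> left_modular_element L x"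
    using assms(2) unfolding trim_def left_modular_def by blast
  obtain c r where bot: "\<And>z. z \<in> L \<Longrightarrow> c 0 \<le> z" and top: "\<And>z. z \<in> L \<Longrightarrow> z \<le> c r"
    and cov: "\<And>i. i < r \<Longrightarrow> covered_by L (c i) (c (Suc i))" and "\<And>i. i \<le> r \<Longrightarrow> c i \<in> C"
    using maxchain_covers[OF L C(1)] by metis
  then have lm: "left_modular_element L (c i)" if "i \<le> r" for i using C(2) that by blast
  then have cL: "c i \<in> L" if "i \<le> r" for i using that unfolding left_modular_element_def by blast
  have mono: "c i \<le> c k" if "i \<le> k" "k \<le> r" for i k
    using that
  proof (induction k rule: dec_induct)
    case (step k)
    then show ?case using covered_byD(4)[OF cov[of k]] by auto
  qed simp
  \<comment> \<open>The index of a cover is a step of the left modular chain at which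
    \<open>inf (c i) z\<close> first leaves the elements below \<open>y\<close>.\<close>
  have index: "\<exists>i<r. inf (c i) z \<le> y \<and> \<not> inf (c (Suc i)) z \<le> y" if "covered_by L y z" for y z
  proof -
    note yz = covered_byD[OF that]
    have "\<not> inf (c r) z \<le> y" using top[OF yz(2)] yz(3) by (auto simp: inf.absorb2 dest: leD)
    moreover have "\<not> \<not> inf (c 0) z \<le> y" using bot[OF yz(1)] by (auto intro: le_infI1)
    ultimately show ?thesis
      using ex_least_nat_less[of "\<lambda>i. \<not> inf (c i) z \<le> y" r] by blast
  qed
  \<comment> \<open>The \<open>n\<close> covers of the chain \<open>xs\<close> receive distinct
    indices below \<open>r\<close>.\<close>
  have "n \<le> r"
  proof -
    have xcov: "covered_by L (xs ! k) (xs ! Suc k)" if "k < n" for k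
      using successively_nth[OF xs(3)] that xs(2) by simp
    have "\<forall>k\<in>{..<n}. \<exists>i<r. inf (c i) (xs ! Suc k) \<le> xs ! k \<and> \<not> inf (c (Suc i)) (xs ! Suc k) \<le> xs ! k"
      using index xcov by blast
    then obtain f where f: "\<And>k. k < n \<Longrightarrow> f k < r"
      "\<And>k. k < n \<Longrightarrow> inf (c (f k)) (xs ! Suc k) \<le> xs ! k"
      "\<And>k. k < n \<Longrightarrow> \<not> inf (c (Suc (f k))) (xs ! Suc k) \<le> xs ! k"
      by (metis (no_types, lifting) lessThan_iff)
    have xmono: "xs ! i \<le> xs ! k" if "i \<le> k" "k \<le> n" for i k
      using that
    proof (induction k rule: dec_induct)
      case (step k)
      then show ?case using covered_byD(4)[OF xcov[of k]] by auto
    qed simp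
    have "f k \<noteq> f k'" if k: "k < k'" "k' < n" for k k'
    proof
      assume e: "f k = f k'"
      have kn: "k < n" using k by simp
      note x = covered_byD[OF xcov[OF kn]] and x' = covered_byD[OF xcov[OF k(2)]]
      have "inf (c (Suc (f k))) (xs ! Suc k') \<le> xs ! k'"
        by (rule left_modular_cover_index_distinct[OF L cov[OF f(1)[OF kn]] lm x(1,2) x'(1,2)])
          (use f[OF kn] f[OF k(2)] e k xmono[of "Suc k" k'] x'(4) in auto)
      then show False using f(3)[OF k(2)] e by simp
    qed
    then have "inj_on f {..<n}" by (intro inj_onI) (metis lessThan_iff nat_neq_iff)
    moreover have "f ` {..<n} \<subseteq> {..<r}" using f(1) by auto
    ultimately show ?thesis using card_inj_on_le[of f "{..<n}" "{..<r}"] by simp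
  qed
  have "\<forall>i\<in>{..<r}. \<exists>q\<in>join_irreducibles L. q \<le> c (Suc i) \<and> \<not> q \<le> c i"
    using ex_join_irreducible[OF L] cov covered_byD(1-3) by (metis leD lessThan_iff)
  then obtain j where j: "\<And>i. i < r \<Longrightarrow> j i \<in> join_irreducibles L"
    "\<And>i. i < r \<Longrightarrow> j i \<le> c (Suc i)" "\<And>i. i < r \<Longrightarrow> \<not> j i \<le> c i"
    by (metis (no_types, lifting) lessThan_iff)
  have "\<forall>i\<in>{..<r}. \<exists>q\<in>meet_irreducibles L. c i \<le> q \<and> \<not> c (Suc i) \<le> q"
    using ex_meet_irreducible[OF L] cov covered_byD(1-3) by (metis leD lessThan_iff)
  then obtain m where m: "\<And>i. i < r \<Longrightarrow> m i \<in> meet_irreducibles L"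
    "\<And>i. i < r \<Longrightarrow> c i \<le> m i" "\<And>i. i < r \<Longrightarrow> \<not> c (Suc i) \<le> m i"
    by (metis (no_types, lifting) lessThan_iff)
  have jc: "j i \<le> c k" if "i < k" "k \<le> r" for i k
    using j(2)[of i] mono[of "Suc i" k] that by (meson Suc_leI less_le_trans order.trans)
  have cm: "c i \<le> m k" if "i \<le> k" "k < r" for i k
    using m(2)[of k] mono[of i k] that by (meson less_imp_le order.trans)
  have jm: "j i \<le> m k" if "i < k" "k < r" for i k
    using jc[of i k] m(2)[of k] that by (meson less_imp_le order.trans)
  have jL: "j i \<in> L" and mL: "m i \<in> L" if "i < r" for i
    using j(1)[OF that] m(1)[OF that] unfolding join_irreducibles_def meet_irreducibles_def by auto
  have finJM: "finite (join_irreducibles L)" "finite (meet_irreducibles L)"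
    unfolding join_irreducibles_def meet_irreducibles_def using fs(1) by auto
  have "j i \<noteq> j k" if "i < k" "k < r" for i k
    using jc[of i k] j(3)[of k] that by (metis less_imp_le)
  then have "inj_on j {..<r}" by (intro inj_onI) (metis lessThan_iff nat_neq_iff)
  \<comment> \<open>There are \<open>r \<ge> n\<close> distinct \<open>j i\<close> among only
    \<open>n\<close> join-irreducibles, so they exhaust them. The same count applies to
    \<open>m\<close>.\<close>
  then have J: "j ` {..<r} = join_irreducibles L"
    using j(1) cards(1) \<open>n \<le> r\<close> by (intro card_seteq finJM) (auto simp: card_image)
  have "m i \<noteq> m k" if "i < k" "k < r" for i k
    using cm[of "Suc i" k] m(3)[of i] that by (metis Suc_leI less_trans)
  then have "inj_on m {..<r}" by (intro inj_onI) (metis lessThan_iff nat_neq_iff)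
  then have M: "m ` {..<r} = meet_irreducibles L"
    using m(1) cards(2) \<open>n \<le> r\<close> by (intro card_seteq finJM) (auto simp: card_image)
  have njm: "\<not> j i \<le> m i" if "i < r" for i
  proof
    assume "j i \<le> m i"
    then have "j i \<le> inf (c (Suc i)) (m i)" using j(2)[OF that] by simp
    also have "\<dots> = c i"
      using covered_by_inf_eq_iff[OF L cov[OF that] mL[OF that] m(2)[OF that]] m(3)[OF that] by blast
    finally show False using j(3)[OF that] by blast
  qed
  have ex: "\<exists>i<r. j i \<le> z \<and> y \<le> m i" if yz: "covered_by L y z" for y z
  proof -
    note y = covered_byD[OF yz]
    obtain i where i: "i < r" "inf (c i) z \<le> y" "\<not> inf (c (Suc i)) z \<le> y" using index[OF yz] by blast
    have ci: "c i \<in> L" "c (Suc i) \<in> L" using cL i(1) by auto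
    \<comment> \<open>As \<open>q\<close> is some \<open>j k\<close>, lying below
      \<open>c (Suc i)\<close> but not below \<open>c i\<close> identifies \<open>k\<close> with
      \<open>i\<close>.\<close>
    obtain q where q: "q \<in> join_irreducibles L" "q \<le> inf (c (Suc i)) z" "\<not> q \<le> y"
      using ex_join_irreducible[OF L fs(3)[OF ci(2) y(2)] y(1) i(3)] by blast
    obtain k where k: "k < r" "q = j k" using q(1) J by auto
    have "\<not> q \<le> c i" using q i(2) by (meson le_infI le_infE order.trans)
    then have "i \<le> k" using jc[of k i] k i(1) by (meson less_imp_le not_less)
    moreover have "k \<le> i"
      using j(3)[OF k(1)] mono[of "Suc i" k] k q(2) by (meson Suc_leI le_infE less_imp_le not_less order.trans)
    ultimately have "j i \<le> z" using k(2) q(2) by auto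
    \<comment> \<open>Left modularity shows that \<open>z\<close> is not below
      \<open>sup y (c i)\<close>, which provides a meet-irreducible \<open>q'\<close>; its position
      in the chain is again forced to be \<open>i\<close>.\<close>
    have "inf (sup y (c i)) z = sup y (inf (c i) z)"
      using left_modular_elementD[OF lm y(1,2,4)] i(1) by simp
    also have "\<dots> = y" using i(2) by (simp add: sup.absorb1)
    finally have "\<not> z \<le> sup y (c i)" using y(3) by (auto simp: inf.absorb2)
    then obtain q' where q': "q' \<in> meet_irreducibles L" "sup y (c i) \<le> q'" "\<not> z \<le> q'"
      using ex_meet_irreducible[OF L y(2) fs(4)[OF y(1) ci(1)]] by blast
    obtain k' where k': "k' < r" "q' = m k'" using q'(1) M by auto
    have "sup y (inf (c (Suc i)) z) = z"
      using covered_by_sup_eq_iff[OF L yz fs(3)[OF ci(2) y(2)]] i(3) by simp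
    then have "\<not> c (Suc i) \<le> q'" using q'(2,3) by (metis le_infI1 le_sup_iff)
    then have "k' \<le> i" using cm[of "Suc i" k'] k' by (meson Suc_leI not_less)
    moreover have "i \<le> k'"
      using m(3)[OF k'(1)] mono[of "Suc k'" i] k' q'(2) i(1)
      by (meson Suc_leI le_supE less_imp_le not_less order.trans)
    ultimately have "y \<le> m i" using k'(2) q'(2) by auto
    then show ?thesis using \<open>j i \<le> z\<close> i(1) by blast
  qed
  \<comment> \<open>For \<open>i < k\<close>, both \<open>y\<close> and \<open>j i\<close> are below
    \<open>m k\<close>, hence so is their join \<open>z\<close>, and with it
    \<open>j k\<close>.\<close>
  have uniq: "\<not> i < k" if yz: "covered_by L y z" and "i < r" "j i \<le> z" "y \<le> m i"
    and k: "k < r" "j k \<le> z" "y \<le> m k" for y z i k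
  proof
    assume "i < k"
    note y = covered_byD[OF yz]
    have "\<not> j i \<le> y" using that njm[of i] by (meson order.trans)
    then have "sup y (j i) = z" using covered_by_sup_eq_iff[OF L yz jL] that by blast
    then have "z \<le> m k" using jm[OF \<open>i < k\<close> k(1)] k(3) by auto
    then show False using k njm[of k] by (meson order.trans)
  qed
  have "labelling L {..<r} j m"
    unfolding labelling_def
  proof (intro conjI allI impI ballI)
    show "\<exists>!i. i \<in> {..<r} \<and> j i \<le> y \<and> x \<le> m i" if "covered_by L x y" for x y
      using ex[OF that] uniq[OF that] by (metis lessThan_iff nat_neq_iff)
  qed (use L jL mL njm in auto)
  then have "triangular_labelling L {..<r} j m"
    unfolding triangular_labelling_def using jm by auto
  then show ?thesis by blast
qed

theorem theorem6p2:
  fixes L :: "'a::lattice set"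
  assumes "finite_sublattice L"
  shows "(semidistributive L \<longrightarrow> semidistrim L) \<and> (trim L \<longrightarrow> semidistrim L)"
  using splitting_labelling_semidistrim[OF splitting_labelling_of_semidistributive[OF assms]]
    triangular_labelling_of_trim[OF assms] triangular_labelling_semidistrim by blast

end
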